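(* If $E:\{0,1\}^n\times\{0,1\}^n\to\{0,1\}$ is a classical one-bit output $(k_1,k_2,\varepsilon)$ two-source extractor, then $E$ is a $(k_1+\log\varepsilon^{-1},\,k_2+\log\varepsilon^{-1},\,\sqrt{3\varepsilon/2})$ two-source extractor against quantum knowledge.
   Context: Logarithms are base 2. For a matrix $A$, $|A|_{\mathrm{tr}}=\frac12\mathrm{Tr}\sqrt{A^\dagger A}$; for classical distributions this is the variational distance. $U_m$ is the uniform distribution on $\{0,1\}^m$ (identified with the maximally mixed state). A source $X$ has min-entropy (at least) $k$ if $\Pr[X=x]\le2^{-k}$ for all $x$. A classical $(k_1,k_2,\varepsilon)$ two-source extractor is a function $E:\{0,1\}^n\times\{0,1\}^n\to\{0,1\}^m$ such that for all independent $n$-bit sources $X,Y$ with min-entropies $k_1,k_2$, the distribution of $E(X,Y)$ is within variational distance $\varepsilon$ of $U_m$. Guessing entropy: $H_g(X\leftarrow\rho_X)=-\log\max_M\mathbb{E}_{x\leftarrow X}[\mathrm{Tr}(M_x\rho_x)]$, the maximum being over all POVMs $M=\{M_x\}$ indexed by the values of $X$. $E$ is a $(k_1,k_2,\varepsilon)$ two-source extractor against quantum knowledge if for all independent $n$-bit sources $X,Y$ and all families of density matrices $\{\rho_x\},\{\rho_y\}$ with $H_g(X\leftarrow\rho_X)\ge k_1$ and $H_g(Y\leftarrow\rho_Y)\ge k_2$, $$\Big|\sum_{x,y}p(x)p(y)\,|E(x,y)\rangle\langle E(x,y)|\otimes\rho_x\otimes\rho_y-U_m\otimes\sum_{x,y}p(x)p(y)\rho_x\otimes\rho_y\Big|_{\mathrm{tr}}\le\varepsilon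 .$$ *)

theory Defs
  imports "HOL-Probability.Probability_Mass_Function" "Jordan_Normal_Form.Schur_Decomposition"
begin

section \<open>Finite-dimensional quantum states\<close>

definition tr :: "complex mat \<Rightarrow> complex" where
  "tr A = (\<Sum>i<dim_row A. A $$ (i, i))"

definition sum_mat :: "nat \<Rightarrow> ('i \<Rightarrow> complex mat) \<Rightarrow> 'i set \<Rightarrow> complex mat" where
  "sum_mat d F S = Matrix.mat d d (\<lambda>(i, j). \<Sum>s\<in>S. F s $$ (i, j))"

definition kron :: "complex mat \<Rightarrow> complex mat \<Rightarrow> complex mat" (infixr "\<otimes>\<^sub>k" 72) where
  "kron A B = Matrix.mat (dim_row A * dim_row B) (dim_col A * dim_col B)
     (\<lambda>(i, j). A $$ (i div dim_row B, j div dim_col B) * B $$ (i mod dim_row B, j mod dim_col B))"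

text \<open>On complex numbers, \<open>0 \<le> z\<close> means that \<open>z\<close> is real and nonnegative, so the condition below
  also forces \<open>A\<close> to be Hermitian.\<close>

definition psd :: "nat \<Rightarrow> complex mat \<Rightarrow> bool" where
  "psd d A \<longleftrightarrow> A \<in> carrier_mat d d \<and> (\<forall>v\<in>carrier_vec d. 0 \<le> (A *\<^sub>v v) \<bullet>c v)"

definition density :: "nat \<Rightarrow> complex mat \<Rightarrow> bool" where
  "density d \<rho> \<longleftrightarrow> psd d \<rho> \<and> tr \<rho> = 1"

definition psd_sqrt :: "complex mat \<Rightarrow> complex mat" where
  "psd_sqrt A = (THE B. psd (dim_row A) B \<and> B * B = A)"

text \<open>The norm is normalised with the factor 1/2.\<close>

definition tr_norm :: "complex mat \<Rightarrow> real" where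
  "tr_norm A = 1 / 2 * Re (tr (psd_sqrt (mat_adjoint A * A)))"

definition povm :: "nat \<Rightarrow> 'i set \<Rightarrow> ('i \<Rightarrow> complex mat) \<Rightarrow> bool" where
  "povm d S M \<longleftrightarrow> (\<forall>s\<in>S. psd d (M s)) \<and> sum_mat d M S = 1\<^sub>m d"


section \<open>Sources\<close>

definition bits :: "nat \<Rightarrow> bool list set" where
  "bits n = {x. length x = n}"

definition bit_source :: "nat \<Rightarrow> bool list pmf \<Rightarrow> bool" where
  "bit_source n X \<longleftrightarrow> set_pmf X \<subseteq> bits n"

definition has_min_entropy :: "bool list pmf \<Rightarrow> real \<Rightarrow> bool" where
  "has_min_entropy X k \<longleftrightarrow> (\<forall>x. pmf X x \<le> 2 powr (- k))"

definition variational_distance :: "'a set \<Rightarrow> 'a pmf \<Rightarrow> 'a pmf \<Rightarrow> real" where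
  "variational_distance S P Q = 1 / 2 * (\<Sum>z\<in>S. \<bar>pmf P z - pmf Q z\<bar>)"

text \<open>The supremum is over the compact set of POVMs, hence a maximum; it is positive because
  the trivial guess has success probability at least \<open>1 / 2 ^ n\<close>.\<close>

definition guessing_entropy :: "nat \<Rightarrow> nat \<Rightarrow> bool list pmf \<Rightarrow> (bool list \<Rightarrow> complex mat) \<Rightarrow> real" where
  "guessing_entropy n d X \<rho> =
     - log 2 (SUP M\<in>{M. povm d (bits n) M}. measure_pmf.expectation X (\<lambda>x. Re (tr (M x * \<rho> x))))"


section \<open>Two-source extractors\<close>

text \<open>Independence of the sources is expressed by taking the product distribution.\<close>

definition two_source_extractor ::
  "nat \<Rightarrow> nat \<Rightarrow> real \<Rightarrow> real \<Rightarrow> real \<Rightarrow> (bool list \<Rightarrow> bool list \<Rightarrow> bool list) \<Rightarrow> bool" where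
  "two_source_extractor n m k1 k2 \<epsilon> E \<longleftrightarrow>
     E \<in> bits n \<rightarrow> bits n \<rightarrow> bits m \<and>
     (\<forall>X Y. bit_source n X \<longrightarrow> bit_source n Y \<longrightarrow> has_min_entropy X k1 \<longrightarrow> has_min_entropy Y k2 \<longrightarrow>
        variational_distance (bits m)
          (map_pmf (\<lambda>(x, y). E x y) (pair_pmf X Y)) (pmf_of_set (bits m)) \<le> \<epsilon>)"

text \<open>The projector onto the computational basis vector labelled by \<open>z\<close>; the basis is ordered by
  reading a bit string as a binary number.\<close>

definition basis_proj :: "bool list \<Rightarrow> complex mat" where
  "basis_proj z = (let k = horner_sum of_bool 2 z in
     Matrix.mat (2 ^ length z) (2 ^ length z) (\<lambda>(i, j). if i = k \<and> j = k then 1 else 0))"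

definition maximally_mixed :: "nat \<Rightarrow> complex mat" where
  "maximally_mixed d = (1 / of_nat d) \<cdot>\<^sub>m 1\<^sub>m d"

definition quantum_two_source_extractor ::
  "nat \<Rightarrow> nat \<Rightarrow> real \<Rightarrow> real \<Rightarrow> real \<Rightarrow> (bool list \<Rightarrow> bool list \<Rightarrow> bool list) \<Rightarrow> bool" where
  "quantum_two_source_extractor n m k1 k2 \<epsilon> E \<longleftrightarrow>
     E \<in> bits n \<rightarrow> bits n \<rightarrow> bits m \<and>
     (\<forall>X Y d1 d2 \<rho> \<sigma>.
        bit_source n X \<longrightarrow> bit_source n Y \<longrightarrow>
        (\<forall>x\<in>bits n. density d1 (\<rho> x)) \<longrightarrow> (\<forall>y\<in>bits n. density d2 (\<sigma> y)) \<longrightarrow>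
        guessing_entropy n d1 X \<rho> \<ge> k1 \<longrightarrow> guessing_entropy n d2 Y \<sigma> \<ge> k2 \<longrightarrow>
        tr_norm
          (sum_mat (2 ^ m * (d1 * d2))
             (\<lambda>(x, y). of_real (pmf X x * pmf Y y) \<cdot>\<^sub>m (basis_proj (E x y) \<otimes>\<^sub>k \<rho> x \<otimes>\<^sub>k \<sigma> y))
             (bits n \<times> bits n)
           - maximally_mixed (2 ^ m) \<otimes>\<^sub>k
             sum_mat (d1 * d2)
               (\<lambda>(x, y). of_real (pmf X x * pmf Y y) \<cdot>\<^sub>m (\<rho> x \<otimes>\<^sub>k \<sigma> y))
               (bits n \<times> bits n)) \<le> \<epsilon>)"

end

theory Submission
  imports Defs "HOL-Computational_Algebra.Fundamental_Theorem_Algebra"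
begin

text \<open>For one output bit the error operator is \<open>D = \<Sum> p(x) q(y) s(x, y) / 2 \<cdot> Z \<otimes> \<rho>\<^sub>x \<otimes> \<sigma>\<^sub>y\<close> with the
  sign \<open>s(x, y) = \<plusminus>1\<close> of \<open>E x y\<close> and \<open>Z = diag(1, -1)\<close>. A weighted Cauchy-Schwarz inequality bounds
  \<open>(tr \<bar>D\<bar>)\<^sup>2\<close> by \<open>tr (D K D K) \<cdot> tr (K\<^sup>-\<^sup>2)\<close>. Choosing \<open>K\<close> as the inverse square root of the (slightly
  shifted) product of the two average states turns \<open>tr (D K D K)\<close> into the correlation of \<open>s(x, y)\<close>
  with \<open>s(x', y')\<close>, where \<open>x'\<close> and \<open>y'\<close> are the outcomes of the pretty good measurements on the two
  states. These outcomes are classical side information with the same guessing bounds, so Markov's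
  inequality makes both conditional sources have min-entropy \<open>k1\<close> and \<open>k2\<close> except with probability
  \<open>2 \<epsilon>\<close>, and the classical extractor property applies. The constant \<open>3 / 2\<close> leaves room
  for the shift of the average states by multiples of the identity.\<close>

subsection \<open>Adjoint and trace\<close>

text \<open>The best distinguisher for \<open>D\<close> may act jointly on the side information of
  both sources. Conditioning on a joint outcome can destroy their independence, so the classical
  hypothesis cannot be applied to that distinguisher directly. Cauchy-Schwarz eliminates it: a
  second copy of \<open>D\<close> takes the place of its sign operator. Because \<open>K\<close> is
  a product, the summation index of that copy becomes a pair of outcomes of two separate
  measurements, with operators of the form \<open>p(x') K \<rho>(x') K\<close>, and given these
  outcomes the sources stay independent. The exponent \<open>-1/2\<close> serves both factors at
  once: it is the one of the pretty good measurement, and it makes \<open>K\<^sup>-\<^sup>2\<close>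
  a shifted average state with trace close to one (times the dimension 2 of the output bit).

  The extra entropy \<open>log (1 / \<epsilon>)\<close> is the slack for Markov's inequality: it
  makes each guessing probability \<open>\<epsilon>\<close> times the threshold that defines a bad
  outcome. Bias \<open>2 \<epsilon>\<close> on good outcomes plus \<open>2 \<epsilon>\<close> for
  bad ones gives a correlation of \<open>4 \<epsilon>\<close>; without the shifts the final bound
  would be \<open>sqrt \<epsilon>\<close>.\<close>

lemma smult_smult_mat:
  fixes A :: "'a :: semigroup_mult mat"
  shows "a \<cdot>\<^sub>m (b \<cdot>\<^sub>m A) = (a * b) \<cdot>\<^sub>m A"
  by (rule eq_matI) (auto simp: mult.assoc)

lemma mult_carrier_square [simp]:
  "A \<in> carrier_mat d d \<Longrightarrow> B \<in> carrier_mat d d \<Longrightarrow> A * B \<in> carrier_mat d d"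
  by (rule mult_carrier_mat)

lemma minus_mult_minus_mat:
  fixes A B C D :: "'a :: ring mat"
  assumes "A \<in> carrier_mat d d" "B \<in> carrier_mat d d" "C \<in> carrier_mat d d" "D \<in> carrier_mat d d"
  shows "(A - B) * (C - D) = (A * C - A * D) - (B * C - B * D)"
proof -
  have "(A - B) * (C - D) = A * (C - D) - B * (C - D)"
    using assms by (intro minus_mult_distrib_mat) (auto intro!: minus_carrier_mat)
  then show ?thesis using assms by (simp add: mult_minus_distrib_mat[of _ d d _ d])
qed

lemma adjoint_dim [simp]:
  "dim_row (mat_adjoint A) = dim_col A" "dim_col (mat_adjoint A) = dim_row A"
  by (simp_all add: mat_adjoint_def)

lemma adjoint_carrier [simp]: "A \<in> carrier_mat n m \<Longrightarrow> mat_adjoint A \<in> carrier_mat m n"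
  by auto

lemma adjoint_index [simp]:
  fixes A :: "complex mat"
  assumes "i < dim_col A" "j < dim_row A"
  shows "mat_adjoint A $$ (i, j) = cnj (A $$ (j, i))"
  using assms by (simp add: mat_adjoint_def mat_of_rows_def)

lemma adjoint_adjoint [simp]: "mat_adjoint (mat_adjoint A) = (A :: complex mat)"
  by (rule eq_matI) auto

lemma adjoint_mult:
  fixes A B :: "complex mat"
  assumes "A \<in> carrier_mat n m" "B \<in> carrier_mat m k"
  shows "mat_adjoint (A * B) = mat_adjoint B * mat_adjoint A"
  using assms by (intro eq_matI) (auto simp: scalar_prod_def mult.commute)

lemma adjoint_minus:
  fixes A B :: "complex mat"
  assumes "A \<in> carrier_mat n m" "B \<in> carrier_mat n m"
  shows "mat_adjoint (A - B) = mat_adjoint A - mat_adjoint B"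
  using assms by (intro eq_matI) auto

lemma adjoint_mat_diag [simp]:
  "mat_adjoint (mat_diag n f) = mat_diag n (\<lambda>i. cnj (f i))"
  by (rule eq_matI) (auto simp: mat_diag_def)

lemma tr_cyclic:
  assumes "A \<in> carrier_mat n m" "B \<in> carrier_mat m n"
  shows "tr (A * B) = tr (B * A)"
proof -
  have "tr (A * B) = (\<Sum>i<n. \<Sum>j<m. A $$ (i, j) * B $$ (j, i))"
    using assms by (auto simp: tr_def scalar_prod_def atLeast0LessThan intro!: sum.cong)
  also have "\<dots> = (\<Sum>j<m. \<Sum>i<n. B $$ (j, i) * A $$ (i, j))"
    by (subst sum.swap) (simp add: mult.commute)
  also have "\<dots> = tr (B * A)"
    using assms by (auto simp: tr_def scalar_prod_def atLeast0LessThan intro!: sum.cong)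
  finally show ?thesis .
qed

lemma tr_add: "A \<in> carrier_mat n n \<Longrightarrow> B \<in> carrier_mat n n \<Longrightarrow> tr (A + B) = tr A + tr B"
  by (simp add: tr_def sum.distrib)

lemma tr_minus: "A \<in> carrier_mat n n \<Longrightarrow> B \<in> carrier_mat n n \<Longrightarrow> tr (A - B) = tr A - tr B"
  by (simp add: tr_def sum_subtractf)

lemma tr_smult: "A \<in> carrier_mat n n \<Longrightarrow> tr (c \<cdot>\<^sub>m A) = c * tr A"
  by (simp add: tr_def sum_distrib_left)

lemma tr_one [simp]: "tr (1\<^sub>m n) = of_nat n"
  by (simp add: tr_def)

text \<open>The squared Frobenius norm of \<open>B\<close>; later positivity and vanishing arguments
  for traces reduce to it.\<close>

lemma tr_adjoint_mult_self:
  assumes "B \<in> carrier_mat n m"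
  shows "tr (mat_adjoint B * B) = of_real (\<Sum>j<m. \<Sum>i<n. (cmod (B $$ (i, j)))\<^sup>2)"
  using assms by (auto simp: tr_def scalar_prod_def atLeast0LessThan mult.commute
      complex_norm_square intro!: sum.cong simp del: of_real_power)

lemma tr_adjoint_mult_self_nonneg:
  assumes "B \<in> carrier_mat n m"
  shows "0 \<le> tr (mat_adjoint B * B)"
  unfolding tr_adjoint_mult_self[OF assms]
  by (simp add: less_eq_complex_def sum_nonneg)

lemma tr_adjoint_mult_self_eq_0D:
  assumes B: "B \<in> carrier_mat n m" and "tr (mat_adjoint B * B) = 0"
  shows "B = 0\<^sub>m n m"
proof (rule eq_matI)
  have "(\<Sum>j<m. \<Sum>i<n. (cmod (B $$ (i, j)))\<^sup>2) = 0"
    using assms(2) unfolding tr_adjoint_mult_self[OF B] of_real_eq_0_iff .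
  then have "\<forall>j<m. \<forall>i<n. (cmod (B $$ (i, j)))\<^sup>2 = 0"
    by (simp add: sum_nonneg_eq_0_iff sum_nonneg)
  then show "B $$ (i, j) = 0\<^sub>m n m $$ (i, j)" if "i < dim_row (0\<^sub>m n m)" "j < dim_col (0\<^sub>m n m)" for i j
    using that by simp
qed (use B in auto)

subsection \<open>Positive semidefinite matrices\<close>

lemma psd_carrier: "psd d A \<Longrightarrow> A \<in> carrier_mat d d"
  by (simp add: psd_def)

lemma cscalar_adjoint:
  fixes A :: "complex mat"
  assumes "A \<in> carrier_mat n m" "v \<in> carrier_vec n" "w \<in> carrier_vec m"
  shows "(mat_adjoint A *\<^sub>v v) \<bullet>c w = v \<bullet>c (A *\<^sub>v w)"
proof -
  have "(mat_adjoint A *\<^sub>v v) \<bullet>c w = (\<Sum>i<m. \<Sum>j<n. cnj (A $$ (j, i)) * vec_index v j * cnj (vec_index w i))"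
    using assms by (auto simp: scalar_prod_def atLeast0LessThan sum_distrib_right intro!: sum.cong)
  also have "\<dots> = (\<Sum>j<n. \<Sum>i<m. cnj (A $$ (j, i)) * vec_index v j * cnj (vec_index w i))"
    by (rule sum.swap)
  also have "\<dots> = v \<bullet>c (A *\<^sub>v w)"
    using assms by (auto simp: scalar_prod_def atLeast0LessThan sum_distrib_left mult_ac intro!: sum.cong)
  finally show ?thesis .
qed

lemma conjugate_unit_vec: "conjugate (unit_vec d i :: complex vec) = unit_vec d i"
  by (rule eq_vecI) (auto simp: unit_vec_def)

text \<open>Polarisation: the quadratic form is real on all vectors, hence also on sums, which ties
  the two mixed terms to each other.\<close>

lemma psd_hermitian:
  assumes "psd d A"
  shows "mat_adjoint A = A"
proof (rule eq_matI)
  have A: "A \<in> carrier_mat d d" using assms by (rule psd_carrier)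
  define b where "b u v = (A *\<^sub>v u) \<bullet>c v" for u v
  have im: "Im (b u u) = 0" if "u \<in> carrier_vec d" for u
    using assms that unfolding psd_def b_def by (auto simp: less_eq_complex_def)
  have add: "b (u + v) (u + v) = b u u + b v v + b u v + b v u"
    if "u \<in> carrier_vec d" "v \<in> carrier_vec d" for u v
    using A that unfolding b_def
    by (simp add: mult_add_distrib_mat_vec[of _ d d] conjugate_add_vec[of _ d]
        add_scalar_prod_distrib[of _ d] scalar_prod_add_distrib[of _ d])
  have smult: "b (c \<cdot>\<^sub>v u) v = c * b u v" "b u (c \<cdot>\<^sub>v v) = cnj c * b u v"
    if "u \<in> carrier_vec d" "v \<in> carrier_vec d" for u v c
    using A that unfolding b_def by (simp_all add: mult_mat_vec[of _ d d] conjugate_smult_vec)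
  \<comment> \<open>The vector \<open>u + v\<close> compares the imaginary parts of the mixed terms,
    and \<open>u + \<i> v\<close> their real parts.\<close>
  have sym: "b v u = cnj (b u v)" if uv: "u \<in> carrier_vec d" "v \<in> carrier_vec d" for u v
  proof -
    have "Im (b u v + b v u) = 0"
      using im[of "u + v"] im[of u] im[of v] add[of u v] uv by simp
    moreover have "Im (cnj \<i> * b u v + \<i> * b v u) = 0"
      using im[of "u + \<i> \<cdot>\<^sub>v v"] im[of u] im[of v] add[of u "\<i> \<cdot>\<^sub>v v"] uv by (simp add: smult)
    ultimately show ?thesis by (simp add: complex_eq_iff)
  qed
  have idx: "A $$ (i, j) = b (unit_vec d j) (unit_vec d i)" if "i < d" "j < d" for i j
    using A that by (simp add: b_def conjugate_unit_vec)
  show "mat_adjoint A $$ (i, j) = A $$ (i, j)" if "i < dim_row A" "j < dim_col A" for i j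
    using that A idx[of i j] idx[of j i] sym[of "unit_vec d i" "unit_vec d j"] by simp
  show "dim_row (mat_adjoint A) = dim_row A" "dim_col (mat_adjoint A) = dim_col A"
    using A by auto
qed

lemma psd_adjoint_mult_self:
  assumes "B \<in> carrier_mat n d"
  shows "psd d (mat_adjoint B * B)"
  unfolding psd_def
proof (intro conjI ballI)
  fix v :: "complex vec" assume v: "v \<in> carrier_vec d"
  have "(mat_adjoint B * B *\<^sub>v v) \<bullet>c v = (B *\<^sub>v v) \<bullet>c (B *\<^sub>v v)"
    using assms v cscalar_adjoint[OF assms, of "B *\<^sub>v v" v]
    by (simp add: assoc_mult_mat_vec[of _ d n _ d])
  also have "\<dots> \<ge> 0" by (rule conjugate_square_ge_0_vec)
  finally show "0 \<le> (mat_adjoint B * B *\<^sub>v v) \<bullet>c v" .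
qed (use assms in auto)

lemma smult_mat_mult_vec:
  assumes "A \<in> carrier_mat n m" "v \<in> carrier_vec m"
  shows "(c \<cdot>\<^sub>m A) *\<^sub>v v = c \<cdot>\<^sub>v (A *\<^sub>v v)"
  using assms by (intro eq_vecI) (auto simp: smult_scalar_prod_distrib[of _ m])

lemma psd_add:
  assumes "psd d A" "psd d B"
  shows "psd d (A + B)"
  using assms unfolding psd_def
  by (auto simp: add_mult_distrib_mat_vec[of _ d d] add_scalar_prod_distrib[of _ d] intro!: add_nonneg_nonneg)

lemma psd_smult:
  assumes "psd d A" "c \<ge> 0"
  shows "psd d (complex_of_real c \<cdot>\<^sub>m A)"
  using assms unfolding psd_def
  by (auto simp: smult_mat_mult_vec[of _ d d] less_eq_complex_def)

lemma psd_one: "psd d (1\<^sub>m d)"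
  by (auto simp: psd_def intro!: conjugate_square_ge_0_vec)

lemma psd_conj:
  assumes "psd d A" "B \<in> carrier_mat d n"
  shows "psd n (mat_adjoint B * A * B)"
  unfolding psd_def
proof (intro conjI ballI)
  have A: "A \<in> carrier_mat d d" using assms(1) by (rule psd_carrier)
  fix v :: "complex vec" assume v: "v \<in> carrier_vec n"
  have "(mat_adjoint B * A * B *\<^sub>v v) \<bullet>c v = (A *\<^sub>v (B *\<^sub>v v)) \<bullet>c (B *\<^sub>v v)"
    using assms A v cscalar_adjoint[OF assms(2), of "A *\<^sub>v (B *\<^sub>v v)" v]
    by (subst assoc_mult_mat_vec[of _ n d _ n], auto intro!: carrier_matI)
      (subst assoc_mult_mat_vec[of _ n d _ d], auto)
  also have "\<dots> \<ge> 0" using assms v by (simp add: psd_def)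
  finally show "0 \<le> (mat_adjoint B * A * B *\<^sub>v v) \<bullet>c v" .
qed (use assms psd_carrier in auto)

lemma psd_sum_mat:
  assumes "finite S" "\<And>s. s \<in> S \<Longrightarrow> psd d (F s)"
  shows "psd d (sum_mat d F S)"
  using assms
proof (induction S rule: finite_induct)
  case empty
  have "sum_mat d F {} = 0\<^sub>m d d" by (rule eq_matI) (auto simp: sum_mat_def)
  moreover have "0\<^sub>m d d *\<^sub>v v = 0\<^sub>v d" if "v \<in> carrier_vec d" for v :: "complex vec"
    using that by (intro eq_vecI) auto
  ultimately show ?case by (auto simp: psd_def)
next
  case (insert s S)
  have "sum_mat d F (insert s S) = F s + sum_mat d F S"
    using insert psd_carrier[of d "F s"] by (intro eq_matI) (auto simp: sum_mat_def)
  then show ?case using insert by (simp add: psd_add)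
qed

subsection \<open>The spectral theorem\<close>

definition unitary_mat :: "nat \<Rightarrow> complex mat \<Rightarrow> bool" where
  "unitary_mat d U \<longleftrightarrow> U \<in> carrier_mat d d \<and> mat_adjoint U * U = 1\<^sub>m d \<and> U * mat_adjoint U = 1\<^sub>m d"

lemma unitary_matI:
  assumes "U \<in> carrier_mat d d" "mat_adjoint U * U = 1\<^sub>m d"
  shows "unitary_mat d U"
  using assms mat_mult_left_right_inverse[of "mat_adjoint U" d U] by (simp add: unitary_mat_def)

lemma complex_mat_has_eigenvector:
  fixes A :: "complex mat"
  assumes A: "A \<in> carrier_mat n n" and "n > 0"
  obtains v e where "v \<in> carrier_vec n" "v \<noteq> 0\<^sub>v n" "A *\<^sub>v v = e \<cdot>\<^sub>v v"
proof -
  have "degree (char_poly A) = n"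
    using degree_monic_char_poly[OF A] by simp
  then have "\<not> constant (poly (char_poly A))"
    using \<open>n > 0\<close> by (simp add: constant_degree)
  then obtain e where "poly (char_poly A) e = 0"
    using fundamental_theorem_of_algebra by blast
  then have "eigenvalue A e"
    using eigenvalue_root_char_poly[OF A] by simp
  then show thesis
    using that A unfolding eigenvalue_def eigenvector_def by auto
qed

text \<open>An eigenvector is completed to a basis and orthogonalised without being changed itself.
  Column 0 of \<open>U\<close> is then an eigenvector, and orthonormality of the columns gives the
  stated entries.\<close>

lemma unitary_with_first_eigenvector:
  fixes A :: "complex mat"
  assumes A: "A \<in> carrier_mat n n" and n: "n > 0"
  obtains U e where "unitary_mat n U"
    "\<And>i. i < n \<Longrightarrow> (mat_adjoint U * A * U) $$ (i, 0) = (if i = 0 then e else 0)"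
proof -
  obtain v e where v: "v \<in> carrier_vec n" "v \<noteq> 0\<^sub>v n" and ev: "A *\<^sub>v v = e \<cdot>\<^sub>v v"
    using complex_mat_has_eigenvector[OF A n] .
  interpret cof_vec_space n "TYPE(complex)" .
  define b where "b = basis_completion v"
  define ws where "ws = gram_schmidt n b"
  have b: "distinct b" "\<not> lin_dep (set b)" "set b \<subseteq> carrier_vec n" "hd b = v" "length b = n"
    using basis_completion[OF v, folded b_def] by auto
  then obtain vs where "b = v # vs" using n by (cases b) auto
  then have hd: "hd ws = v"
    using gram_schmidt_hd[OF v(1), of vs] by (simp add: ws_def)
  have ws: "set ws \<subseteq> carrier_vec n" "corthogonal ws" "length ws = n"
    using gram_schmidt_result[OF b(3,1,2) refl, folded ws_def] b(5) by auto
  have wsc: "ws ! i \<in> carrier_vec n" if "i < n" for i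
    using that ws by auto
  \<comment> \<open>Gram-Schmidt gives vectors that are orthogonal and nonzero but not of unit
    length; \<open>c\<close> normalises them.\<close>
  define c where "c i = 1 / sqrt (Re (ws ! i \<bullet>c ws ! i))" for i
  define U where "U = Matrix.mat n n (\<lambda>(i, j). of_real (c j) * vec_index (ws ! j) i)"
  have U: "U \<in> carrier_mat n n" by (simp add: U_def)
  have colU: "col U j = of_real (c j) \<cdot>\<^sub>v ws ! j" if "j < n" for j
    using that wsc[OF that] by (intro eq_vecI) (auto simp: U_def)
  have "(mat_adjoint U * U) $$ (i, j) = 1\<^sub>m n $$ (i, j)" if ij: "i < n" "j < n" for i j
  proof -
    have "(mat_adjoint U * U) $$ (i, j) = of_real (c i * c j) * (ws ! j \<bullet>c ws ! i)"
      using ij wsc[OF ij(1)] wsc[OF ij(2)]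
      by (simp add: U_def scalar_prod_def sum_distrib_left mult_ac)
    also have "\<dots> = (if i = j then 1 else 0)"
    proof (cases "i = j")
      case True
      define q where "q = ws ! i \<bullet>c ws ! i"
      have "q \<noteq> 0" using corthogonalD[OF ws(2), of i i] ij ws(3) by (simp add: q_def)
      moreover have "q \<ge> 0" unfolding q_def by (rule conjugate_square_ge_0_vec)
      ultimately have "q = of_real (Re q)" "Re q > 0"
        by (auto simp: less_eq_complex_def complex_eq_iff)
      then have "of_real (c i * c i) * q = of_real (c i * c i * Re q)"
        by (metis of_real_mult)
      also have "\<dots> = 1" using \<open>Re q > 0\<close> by (simp add: c_def flip: q_def)
      finally show ?thesis using True by (simp add: q_def)
    next
      case False
      then show ?thesis using corthogonalD[OF ws(2), of j i] ij ws(3) by simp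
    qed
    finally show ?thesis using ij by simp
  qed
  then have UU: "mat_adjoint U * U = 1\<^sub>m n"
    using U by (intro eq_matI) auto
  have "hd ws = ws ! 0" using ws(3) n by (simp add: hd_conv_nth flip: length_greater_0_conv)
  then have "col U 0 = of_real (c 0) \<cdot>\<^sub>v v" using colU[OF n] hd by simp
  then have "A *\<^sub>v col U 0 = e \<cdot>\<^sub>v col U 0"
    using A v(1) ev by (simp add: mult_mat_vec[of _ n n] smult_smult_assoc mult.commute)
  then have "(mat_adjoint U * (A * U)) $$ (i, 0) = (if i = 0 then e else 0)" if i: "i < n" for i
  proof -
    have "(mat_adjoint U * (A * U)) $$ (i, 0) = row (mat_adjoint U) i \<bullet> (A *\<^sub>v col U 0)"
      using A U n i by (simp add: col_mult2[OF A U n, symmetric] del: col_mult2)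
    also have "\<dots> = e * (mat_adjoint U * U) $$ (i, 0)"
      unfolding \<open>A *\<^sub>v col U 0 = e \<cdot>\<^sub>v col U 0\<close> using U n i by simp
    finally show ?thesis using UU n i by simp
  qed
  moreover have "mat_adjoint U * (A * U) = mat_adjoint U * A * U"
    using A U by (simp add: assoc_mult_mat[of _ n n _ n _ n])
  ultimately show thesis
    using that unitary_matI[OF U UU] by metis
qed

text \<open>Deflation: in a unitary basis that starts with an eigenvector, the first column is a
  multiple of a unit vector. Hermitian symmetry gives the same for the first row, so a 1 by 1 block
  splits off and induction treats the rest.\<close>

theorem hermitian_spectral:
  assumes "A \<in> carrier_mat d d" "mat_adjoint A = A"
  obtains U f where "unitary_mat d U"
    "A = U * mat_diag d (\<lambda>i. complex_of_real (f i)) * mat_adjoint U"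
proof -
  have "\<exists>U f. unitary_mat d U \<and> A = U * mat_diag d (\<lambda>i. complex_of_real (f i)) * mat_adjoint U"
    using assms
  proof (induction d arbitrary: A)
    case 0
    then have "unitary_mat 0 (1\<^sub>m 0)" by (intro unitary_matI) auto
    moreover have "A = 1\<^sub>m 0 * mat_diag 0 (\<lambda>i. complex_of_real (f i)) * mat_adjoint (1\<^sub>m 0)" for f
      using 0 by (intro eq_matI) auto
    ultimately show ?case by blast
  next
    case (Suc d)
    note A = Suc.prems(1)
    obtain W e where W: "unitary_mat (Suc d) W" and
      col0: "\<And>i. i < Suc d \<Longrightarrow> (mat_adjoint W * A * W) $$ (i, 0) = (if i = 0 then e else 0)"
      using unitary_with_first_eigenvector[OF A] by auto
    have Wc: "W \<in> carrier_mat (Suc d) (Suc d)" using W by (simp add: unitary_mat_def)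
    define B where "B = mat_adjoint W * A * W"
    have B: "B \<in> carrier_mat (Suc d) (Suc d)" using Wc A by (simp add: B_def)
    have "mat_adjoint B = mat_adjoint W * (A * W)"
      unfolding B_def using Wc A Suc.prems(2)
      by (subst adjoint_mult[of _ "Suc d" "Suc d" _ "Suc d"], auto intro!: carrier_matI)
        (subst adjoint_mult[of _ "Suc d" "Suc d" _ "Suc d"], auto)
    then have Bh: "mat_adjoint B = B"
      using Wc A by (simp add: B_def assoc_mult_mat[of _ "Suc d" "Suc d" _ "Suc d" _ "Suc d"])
    have Bsym: "B $$ (j, i) = cnj (B $$ (i, j))" if "i < Suc d" "j < Suc d" for i j
      using that B adjoint_index[of j B i] by (simp add: Bh)
    have Bcol: "B $$ (i, 0) = (if i = 0 then e else 0)" if "i < Suc d" for i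
      using col0[OF that] by (simp add: B_def)
    have Brow: "B $$ (0, i) = (if i = 0 then e else 0)" if "i < Suc d" for i
      using Bsym[of i 0] Bcol[OF that] Bcol[of 0] that by (cases "i = 0") auto
    \<comment> \<open>A diagonal entry of a Hermitian matrix is real; this is why \<open>f\<close>
      can take real values.\<close>
    have "cnj e = e" using Bsym[of 0 0] Bcol[of 0] by simp
    then have e: "e = of_real (Re e)" by (simp add: complex_eq_iff)
    define A' where "A' = Matrix.mat d d (\<lambda>(i, j). B $$ (Suc i, Suc j))"
    have A': "A' \<in> carrier_mat d d" "mat_adjoint A' = A'"
      by (auto simp: A'_def Bsym[symmetric] intro!: eq_matI)
    obtain V f where V: "unitary_mat d V"
      and f: "A' = V * mat_diag d (\<lambda>i. complex_of_real (f i)) * mat_adjoint V"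
      using Suc.IH[OF A'] by auto
    have Vc: "V \<in> carrier_mat d d" using V by (simp add: unitary_mat_def)
    let ?z1 = "0\<^sub>m 1 d :: complex mat" and ?z2 = "0\<^sub>m d 1 :: complex mat"
    define V' where "V' = four_block_mat (1\<^sub>m 1) ?z1 ?z2 V"
    define g where "g i = (if i = 0 then Re e else f (i - 1))" for i
    define D where "D = mat_diag d (\<lambda>i. complex_of_real (f i))"
    define D' where "D' = mat_diag (Suc d) (\<lambda>i. complex_of_real (g i))"
    have adjV': "mat_adjoint V' = four_block_mat (1\<^sub>m 1) ?z1 ?z2 (mat_adjoint V)"
      using Vc by (intro eq_matI) (auto simp: V'_def)
    have D': "D' = four_block_mat (mat_diag 1 (\<lambda>_. e)) ?z1 ?z2 D"
      by (intro eq_matI) (auto simp: D'_def D_def mat_diag_def g_def e[symmetric])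
    have Beq: "B = four_block_mat (mat_diag 1 (\<lambda>_. e)) ?z1 ?z2 A'"
      using B Brow Bcol by (intro eq_matI) (auto simp: A'_def mat_diag_def)
    have V'c: "V' \<in> carrier_mat (Suc d) (Suc d)" using Vc by (auto simp: V'_def)
    have D'c: "D' \<in> carrier_mat (Suc d) (Suc d)" by (simp add: D'_def)
    have Dc: "D \<in> carrier_mat d d" by (simp add: D_def)
    have aVc: "mat_adjoint V \<in> carrier_mat d d" using Vc by simp
    have VDc: "V * D \<in> carrier_mat d d" using Vc Dc by simp
    have d1: "mat_diag 1 (\<lambda>_. e) \<in> carrier_mat 1 1" by simp
    have "V' * D' = four_block_mat (mat_diag 1 (\<lambda>_. e)) ?z1 ?z2 (V * D)"
      unfolding V'_def D'
      by (subst mult_four_block_mat[OF one_carrier_mat zero_carrier_mat zero_carrier_mat Vc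
          d1 zero_carrier_mat zero_carrier_mat Dc])
        (use Vc Dc carrier_matD[OF d1] in \<open>auto simp: left_mult_zero_mat[of _ d] right_mult_zero_mat[of _ _ d]\<close>)
    note VD = this
    have "V' * D' * mat_adjoint V' = four_block_mat (mat_diag 1 (\<lambda>_. e)) ?z1 ?z2 (V * D * mat_adjoint V)"
      unfolding adjV' VD
      by (subst mult_four_block_mat[OF d1 zero_carrier_mat zero_carrier_mat VDc
          one_carrier_mat zero_carrier_mat zero_carrier_mat aVc])
        (use Vc Dc aVc carrier_matD[OF d1] in
          \<open>auto simp: left_mult_zero_mat[of _ d] right_mult_zero_mat[of _ _ d] right_mult_one_mat[of _ _ 1]\<close>)
    then have BV: "B = V' * D' * mat_adjoint V'"
      using f Beq by (simp add: D_def)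
    have "mat_adjoint V' * V' = 1\<^sub>m (Suc d)"
      unfolding adjV' unfolding V'_def
      by (subst mult_four_block_mat[OF one_carrier_mat zero_carrier_mat zero_carrier_mat aVc
          one_carrier_mat zero_carrier_mat zero_carrier_mat Vc])
        (use Vc aVc V in \<open>auto simp: unitary_mat_def intro!: eq_matI\<close>)
    then have V'u: "unitary_mat (Suc d) V'" using V'c by (intro unitary_matI)
    define U where "U = W * V'"
    have Uc: "U \<in> carrier_mat (Suc d) (Suc d)" using Wc V'c by (simp add: U_def)
    have adjU: "mat_adjoint U = mat_adjoint V' * mat_adjoint W"
      unfolding U_def by (rule adjoint_mult[OF Wc V'c])
    note assoc = assoc_mult_mat[of _ "Suc d" "Suc d" _ "Suc d" _ "Suc d"]
    have aWc: "mat_adjoint W \<in> carrier_mat (Suc d) (Suc d)" using Wc by simp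
    have aV'c: "mat_adjoint V' \<in> carrier_mat (Suc d) (Suc d)" using V'c by simp
    have "mat_adjoint U * U = mat_adjoint V' * ((mat_adjoint W * W) * V')"
      unfolding adjU unfolding U_def using Wc V'c aWc aV'c by (simp add: assoc)
    also have "\<dots> = 1\<^sub>m (Suc d)"
      using W V'u V'c unfolding unitary_mat_def by simp
    finally have Uu: "unitary_mat (Suc d) U" using Uc by (intro unitary_matI)
    have "U * D' * mat_adjoint U = W * B * mat_adjoint W"
      unfolding adjU BV unfolding U_def using Wc V'c aWc aV'c D'c by (simp add: assoc)
    also have "\<dots> = (W * mat_adjoint W) * A * (W * mat_adjoint W)"
      unfolding B_def using Wc aWc A by (simp add: assoc)
    also have "\<dots> = A" using W A unfolding unitary_mat_def by simp
    finally show ?case using Uu unfolding D'_def by metis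
  qed
  then show thesis using that by blast
qed

subsection \<open>Functional calculus and the trace norm\<close>

text \<open>Eigenvalues are listed by position, so a function of the matrix is formed by changing
  \<open>f\<close> while \<open>U\<close> stays fixed.\<close>

definition spectral_mat :: "nat \<Rightarrow> complex mat \<Rightarrow> (nat \<Rightarrow> real) \<Rightarrow> complex mat" where
  "spectral_mat d U f = U * mat_diag d (\<lambda>i. complex_of_real (f i)) * mat_adjoint U"

lemma hermitian_spectral_mat:
  assumes "A \<in> carrier_mat d d" "mat_adjoint A = A"
  obtains U f where "unitary_mat d U" "A = spectral_mat d U f"
  using hermitian_spectral[OF assms] unfolding spectral_mat_def by metis

lemma spectral_mat_carrier [simp]: "unitary_mat d U \<Longrightarrow> spectral_mat d U f \<in> carrier_mat d d"
  by (auto simp: spectral_mat_def unitary_mat_def intro!: carrier_matI)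

lemma spectral_mat_mult:
  assumes "unitary_mat d U"
  shows "spectral_mat d U f * spectral_mat d U g = spectral_mat d U (\<lambda>i. f i * g i)"
proof -
  have U: "U \<in> carrier_mat d d" "mat_adjoint U \<in> carrier_mat d d" "mat_adjoint U * U = 1\<^sub>m d"
    using assms by (auto simp: unitary_mat_def)
  let ?D = "\<lambda>f. mat_diag d (\<lambda>i. complex_of_real (f i))"
  have "spectral_mat d U f * spectral_mat d U g = U * (?D f * ((mat_adjoint U * U) * (?D g * mat_adjoint U)))"
    unfolding spectral_mat_def using U(1,2) by (simp add: assoc_mult_mat[of _ d d _ d _ d])
  also have "\<dots> = U * ((?D f * ?D g) * mat_adjoint U)"
    unfolding U(3) using U(1,2)
    by (simp add: assoc_mult_mat[of _ d d _ d _ d] left_mult_one_mat[of _ d d] del: mat_diag_diag)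
  also have "\<dots> = spectral_mat d U (\<lambda>i. f i * g i)"
    unfolding spectral_mat_def using U(1,2) by (simp add: assoc_mult_mat[of _ d d _ d _ d])
  finally show ?thesis .
qed

lemma spectral_mat_one: "unitary_mat d U \<Longrightarrow> spectral_mat d U (\<lambda>_. 1) = 1\<^sub>m d"
  by (auto simp: spectral_mat_def unitary_mat_def)

lemma spectral_mat_hermitian:
  assumes "unitary_mat d U"
  shows "mat_adjoint (spectral_mat d U f) = spectral_mat d U f"
proof -
  have U: "U \<in> carrier_mat d d" "mat_adjoint U \<in> carrier_mat d d"
    using assms by (auto simp: unitary_mat_def)
  have UD: "U * mat_diag d (\<lambda>i. complex_of_real (f i)) \<in> carrier_mat d d" using U by simp
  show ?thesis
    unfolding spectral_mat_def adjoint_mult[OF UD U(2)] adjoint_mult[OF U(1) mat_diag_dim]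
    using U by (simp add: assoc_mult_mat[of _ d d _ d _ d])
qed

text \<open>The matrix equals \<open>S\<close> adjoint times \<open>S\<close>, where
  \<open>S\<close> has the eigenvalues \<open>sqrt (f i)\<close> in the same basis.\<close>

lemma spectral_mat_psd:
  assumes "unitary_mat d U" "\<And>i. i < d \<Longrightarrow> f i \<ge> 0"
  shows "psd d (spectral_mat d U f)"
proof -
  have "spectral_mat d U f = spectral_mat d U (\<lambda>i. sqrt (f i) * sqrt (f i))"
    unfolding spectral_mat_def
    by (rule arg_cong[where f = "\<lambda>D. U * D * mat_adjoint U"])
      (auto simp: mat_diag_def assms simp flip: of_real_mult intro!: eq_matI)
  also have "\<dots> = mat_adjoint (spectral_mat d U (\<lambda>i. sqrt (f i))) * spectral_mat d U (\<lambda>i. sqrt (f i))"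
    using assms(1) by (simp add: spectral_mat_hermitian spectral_mat_mult)
  finally show ?thesis
    using psd_adjoint_mult_self[OF spectral_mat_carrier[OF assms(1)]] by simp
qed

lemma psd_diag_nonneg:
  assumes "psd d A" "i < d"
  shows "0 \<le> A $$ (i, i)"
proof -
  have "(A *\<^sub>v unit_vec d i) \<bullet>c unit_vec d i = A $$ (i, i)"
    using assms psd_carrier[OF assms(1)] by (simp add: conjugate_unit_vec)
  then show ?thesis using assms unfolding psd_def by (metis unit_vec_carrier)
qed

text \<open>Conjugation by \<open>U\<close> recovers the diagonal matrix of eigenvalues. Congruence
  preserves positivity, and a positive matrix has nonnegative diagonal entries.\<close>

lemma psd_spectral_mat:
  assumes "psd d A"
  obtains U f where "unitary_mat d U" "A = spectral_mat d U f" "\<And>i. i < d \<Longrightarrow> f i \<ge> 0"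
proof -
  obtain U f where U: "unitary_mat d U" and A: "A = spectral_mat d U f"
    using hermitian_spectral_mat[OF psd_carrier psd_hermitian] assms by metis
  have Uc: "U \<in> carrier_mat d d" "mat_adjoint U \<in> carrier_mat d d"
      "mat_adjoint U * U = 1\<^sub>m d"
    using U by (auto simp: unitary_mat_def)
  let ?D = "mat_diag d (\<lambda>i. complex_of_real (f i))"
  have "mat_adjoint U * A * U = (mat_adjoint U * U) * ?D * (mat_adjoint U * U)"
    unfolding A spectral_mat_def using Uc(1,2) by (simp add: assoc_mult_mat[of _ d d _ d _ d])
  also have "\<dots> = ?D" using Uc(3) by (simp add: left_mult_one_mat[of _ d d] right_mult_one_mat[of _ d d])
  finally have "psd d ?D" using psd_conj[OF assms Uc(1)] by simp
  then have "f i \<ge> 0" if "i < d" for i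
    using psd_diag_nonneg[of d ?D i] that by (simp add: mat_diag_def less_eq_complex_def)
  then show thesis using that U A by blast
qed

section \<open>Existence and uniqueness of positive square roots\<close>

lemma psd_sqrt_exists:
  assumes "psd d A"
  obtains B where "psd d B" "B * B = A"
proof -
  obtain U f where U: "unitary_mat d U" and A: "A = spectral_mat d U f" and f: "\<And>i. i < d \<Longrightarrow> f i \<ge> 0"
    using psd_spectral_mat[OF assms] by blast
  \<comment> \<open>The absolute value lets the root square back at every index, also from
    \<open>d\<close> on, where the sign of \<open>f\<close> is unknown.\<close>
  have "spectral_mat d U (\<lambda>i. sqrt \<bar>f i\<bar>) * spectral_mat d U (\<lambda>i. sqrt \<bar>f i\<bar>) = spectral_mat d U (\<lambda>i. \<bar>f i\<bar>)"
    using U by (simp add: spectral_mat_mult)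
  also have "\<dots> = A" unfolding A spectral_mat_def
    by (rule arg_cong[where f = "\<lambda>D. U * D * mat_adjoint U"])
      (auto simp: mat_diag_def f intro!: eq_matI)
  finally show thesis by (rule that[rotated]) (use U in \<open>auto intro: spectral_mat_psd\<close>)
qed

text \<open>The product itself need not be positive, but with \<open>A = P * P\<close> and
  \<open>B = Q * Q\<close> cyclicity turns its trace into the squared Frobenius norm of
  \<open>Q * P\<close>.\<close>

lemma tr_psd_mult_nonneg:
  assumes A: "psd d A" and B: "psd d B"
  shows "0 \<le> tr (A * B)"
proof -
  obtain P where P: "psd d P" "P * P = A" using psd_sqrt_exists[OF A] .
  obtain Q where Q: "psd d Q" "Q * Q = B" using psd_sqrt_exists[OF B] .
  have c: "P \<in> carrier_mat d d" "Q \<in> carrier_mat d d" "Q * P \<in> carrier_mat d d"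
    using psd_carrier[OF P(1)] psd_carrier[OF Q(1)] by auto
  have "tr (A * B) = tr (P * (P * Q * Q))"
    using c by (simp flip: P(2) Q(2) add: assoc_mult_mat[of _ d d _ d _ d])
  also have "\<dots> = tr (P * Q * (Q * P))"
    using c by (subst tr_cyclic[of _ d d]) (auto simp: assoc_mult_mat[of _ d d _ d _ d])
  also have "P * Q = mat_adjoint (Q * P)"
    using c P Q by (simp add: adjoint_mult[of _ d d _ d] psd_hermitian)
  also have "0 \<le> tr (mat_adjoint (Q * P) * (Q * P))"
    using c(3) by (rule tr_adjoint_mult_self_nonneg)
  finally show ?thesis .
qed

text \<open>With \<open>D = B - C\<close>, the identity \<open>B * D + D * C = 0\<close> forces \<open>tr (D * B * D) = tr (D * C * D) = 0\<close>.\<close>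

lemma psd_sqrt_unique:
  assumes B: "psd d B" and C: "psd d C" and eq: "B * B = C * C"
  shows "B = C"
proof -
  define D where "D = B - C"
  have c: "B \<in> carrier_mat d d" "C \<in> carrier_mat d d" "D \<in> carrier_mat d d"
    using psd_carrier[OF B] psd_carrier[OF C] by (auto simp: D_def minus_carrier_mat)
  have Dh: "mat_adjoint D = D"
    unfolding D_def using c B C by (simp add: adjoint_minus[of _ d d] psd_hermitian)
  have "B * D + D * C = B * B - B * C + (B * C - C * C)"
    unfolding D_def using c by (simp add: mult_minus_distrib_mat[of _ d d] minus_mult_distrib_mat[of _ d d])
  also have "\<dots> = 0\<^sub>m d d" unfolding eq using c by (intro eq_matI) auto
  finally have "D * (B * D + D * C) = 0\<^sub>m d d" using c by (simp add: right_mult_zero_mat[of _ d d])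
  then have "D * (B * D) + D * (D * C) = 0\<^sub>m d d"
    using c by (simp add: mult_add_distrib_mat[of _ d d _ d])
  then have "tr (D * (B * D) + D * (D * C)) = tr (0\<^sub>m d d)" by simp
  also have "tr (0\<^sub>m d d) = 0" by (simp add: tr_def)
  finally have "tr (D * (B * D)) + tr (D * (D * C)) = 0" using c by (simp add: tr_add[of _ d])
  moreover have "tr (D * (D * C)) = tr (D * (C * D))"
    using c by (subst tr_cyclic[of _ d d]) (auto simp: assoc_mult_mat[of _ d d _ d _ d])
  moreover have nonneg: "0 \<le> tr (D * (X * D))" if X: "psd d X" for X
  proof -
    have "psd d (mat_adjoint D * X * D)" using psd_conj[OF X c(3)] .
    then have "0 \<le> tr (mat_adjoint D * X * D * 1\<^sub>m d)" by (rule tr_psd_mult_nonneg[OF _ psd_one])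
    then show ?thesis using c(3) psd_carrier[OF X]
      by (simp add: Dh assoc_mult_mat[of _ d d _ d _ d] right_mult_one_mat[of _ d d])
  qed
  ultimately have tr0: "tr (D * (B * D)) = 0" "tr (D * (C * D)) = 0"
    using nonneg[OF B] nonneg[OF C] by (auto simp: add_nonneg_eq_0_iff)
  \<comment> \<open>With \<open>X = Q * Q\<close> the trace is the squared Frobenius norm of
    \<open>Q * D\<close>, so \<open>Q * D\<close> vanishes and \<open>X * D\<close> with it.\<close>
  have zero: "X * D = 0\<^sub>m d d" if X: "psd d X" and "tr (D * (X * D)) = 0" for X
  proof -
    obtain Q where Q: "psd d Q" "Q * Q = X" using psd_sqrt_exists[OF X] .
    have Qc: "Q \<in> carrier_mat d d" using Q psd_carrier by auto
    have "mat_adjoint (Q * D) * (Q * D) = D * (X * D)"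
      using c Qc by (simp add: adjoint_mult[of _ d d _ d] psd_hermitian[OF Q(1)] Dh assoc_mult_mat[of _ d d _ d _ d] flip: Q(2))
    then have "Q * D = 0\<^sub>m d d"
      using that c Qc by (intro tr_adjoint_mult_self_eq_0D) auto
    then have "Q * (Q * D) = 0\<^sub>m d d" using Qc by (simp add: right_mult_zero_mat[of _ d d])
    then show ?thesis using Qc c by (simp flip: Q(2) add: assoc_mult_mat[of _ d d _ d _ d])
  qed
  have "mat_adjoint D * D = B * D - C * D"
    unfolding Dh using c by (simp add: minus_mult_distrib_mat[of _ d d] D_def)
  also have "\<dots> = 0\<^sub>m d d" using zero[OF B tr0(1)] zero[OF C tr0(2)] by simp
  finally have "tr (mat_adjoint D * D) = 0" by (simp add: tr_def)
  then have "D = 0\<^sub>m d d" using c by (intro tr_adjoint_mult_self_eq_0D)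
  then have D0: "(B - C) $$ (i, j) = 0" if "i < d" "j < d" for i j
    using that by (simp add: D_def)
  show ?thesis using c D0 by (intro eq_matI) auto
qed

lemma psd_sqrt_eqI: "psd d B \<Longrightarrow> B * B = A \<Longrightarrow> psd_sqrt A = B"
  unfolding psd_sqrt_def using psd_carrier[of d B]
  by (intro the_equality) (auto intro: psd_sqrt_unique)

section \<open>Trace norm of Hermitian matrices and the weighted Cauchy-Schwarz bound\<close>

text \<open>\<open>W\<close> is the sign of \<open>D\<close>, so \<open>D * W\<close> is the
  absolute value of \<open>D\<close>.\<close>

lemma tr_norm_hermitian:
  assumes "D \<in> carrier_mat d d" "mat_adjoint D = D"
  obtains W where "W \<in> carrier_mat d d" "mat_adjoint W = W" "W * W = 1\<^sub>m d"
    "tr_norm D = 1 / 2 * Re (tr (D * W))"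
proof -
  obtain U f where U: "unitary_mat d U" and D: "D = spectral_mat d U f"
    using hermitian_spectral_mat[OF assms] .
  \<comment> \<open>The sign of zero is set to \<open>1\<close>, so that \<open>W\<close> squares to
    the identity even when \<open>D\<close> is singular.\<close>
  define s where "s i = (if f i \<ge> 0 then 1 else - 1 :: real)" for i
  have "psd_sqrt (mat_adjoint D * D) = spectral_mat d U (\<lambda>i. \<bar>f i\<bar>)"
    using U by (intro psd_sqrt_eqI[of d] spectral_mat_psd) (auto simp: D spectral_mat_hermitian spectral_mat_mult)
  also have "\<dots> = D * spectral_mat d U s"
    unfolding D using U
    by (auto simp: spectral_mat_mult s_def intro!: arg_cong[where f = "spectral_mat d U"])
  finally have "tr_norm D = 1 / 2 * Re (tr (D * spectral_mat d U s))"
    by (simp add: tr_norm_def)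
  moreover have "spectral_mat d U s * spectral_mat d U s = spectral_mat d U (\<lambda>_. 1)"
    using U by (auto simp: spectral_mat_mult s_def intro!: arg_cong[where f = "spectral_mat d U"])
  ultimately show thesis
    using that U by (metis spectral_mat_carrier spectral_mat_hermitian spectral_mat_one)
qed

text \<open>Evaluating at the minimum \<open>t = a / g\<close> gives the claim; for
  \<open>g = 0\<close> a linear function that stays nonnegative must be constant.\<close>

lemma linear_quadratic_discriminant:
  fixes a p g :: real
  assumes "\<And>t. 0 \<le> p - 2 * t * a + t\<^sup>2 * g" "g \<ge> 0"
  shows "a\<^sup>2 \<le> p * g"
proof (cases "g = 0")
  case True
  have "a = 0"
  proof (rule ccontr)
    assume "a \<noteq> 0"
    \<comment> \<open>At this \<open>t\<close> the expression equals \<open>-1\<close>.\<close>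
    then show False using assms(1)[of "(p + 1) / (2 * a)"] True by simp
  qed
  then show ?thesis using True by simp
next
  case False
  then show ?thesis
    using assms(1)[of "a / g"] assms(2) by (simp add: field_simps power2_eq_square)
qed

text \<open>This is a Cauchy-Schwarz inequality with weight \<open>K = G\<^sup>-\<^sup>1\<close>; it comes from
  \<open>tr (X K X K) \<ge> 0\<close> for \<open>X = D - t G W G\<close> with \<open>W\<close> the sign of \<open>D\<close>.\<close>

lemma tr_norm_weighted:
  assumes D: "D \<in> carrier_mat d d" "mat_adjoint D = D"
    and G: "psd d G" and K: "psd d K" and GK: "G * K = 1\<^sub>m d" and KG: "K * G = 1\<^sub>m d"
  shows "(tr_norm D)\<^sup>2 \<le> 1 / 4 * (Re (tr (D * K * (D * K))) * Re (tr (G * G)))"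
proof -
  obtain W where W: "W \<in> carrier_mat d d" "mat_adjoint W = W" "W * W = 1\<^sub>m d"
    and norm: "tr_norm D = 1 / 2 * Re (tr (D * W))"
    using tr_norm_hermitian[OF D] .
  have c: "G \<in> carrier_mat d d" "K \<in> carrier_mat d d" using G K psd_carrier by auto
  note cs = D(1) W(1) c
  note assoc = assoc_mult_mat[of _ d d _ d _ d]
  define p a g q where "p = Re (tr (D * K * (D * K)))" and "a = Re (tr (D * W))"
    and "g = Re (tr (G * G))" and "q = Re (tr (G * W * (G * W)))"
  \<comment> \<open>The squared Frobenius norm of the commutator \<open>G * W - W * G\<close> is
    \<open>2 * (g - q)\<close>, because \<open>W * W = 1\<close>. This removes the unknown
    \<open>W\<close> from the quadratic coefficient below.\<close>
  have "q \<le> g"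
  proof -
    have GW: "G * W \<in> carrier_mat d d" "W * G \<in> carrier_mat d d" using cs by auto
    have "mat_adjoint (G * W - W * G) = W * G - G * W"
      using cs GW G by (simp add: adjoint_minus[of _ d d] adjoint_mult[of _ d d _ d] W psd_hermitian)
    then have "0 \<le> tr ((W * G - G * W) * (G * W - W * G))"
      using tr_adjoint_mult_self_nonneg[of "G * W - W * G" d d] GW by (simp add: minus_carrier_mat)
    also have "(W * G - G * W) * (G * W - W * G)
        = (W * G * (G * W) - W * G * (W * G)) - (G * W * (G * W) - G * W * (W * G))"
      using GW by (intro minus_mult_minus_mat)
    also have "tr \<dots> = tr (W * G * (G * W)) - tr (W * G * (W * G)) - (tr (G * W * (G * W)) - tr (G * W * (W * G)))"
      using GW by (simp add: tr_minus[of _ d] minus_carrier_mat)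
    also have "tr (W * G * (G * W)) = tr (G * W * (W * G))"
      using GW by (rule tr_cyclic[rotated])
    also have "G * W * (W * G) = G * (W * W) * G" using cs by (simp add: assoc)
    also have "\<dots> = G * G" using W(3) cs by (simp add: right_mult_one_mat[of _ d d])
    also have "tr (W * G * (W * G)) = tr (W * (G * W * G))" using cs by (simp add: assoc)
    also have "\<dots> = tr (G * W * (G * W))"
      using cs by (subst tr_cyclic[of _ d d]) (auto simp: assoc)
    finally show ?thesis by (simp add: q_def g_def less_eq_complex_def)
  qed
  have g0: "g \<ge> 0"
    using tr_psd_mult_nonneg[OF G G] by (simp add: g_def less_eq_complex_def)
  have "0 \<le> p - 2 * t * a + t\<^sup>2 * g" for t
  proof -
    define Y where "Y = D * K" 
    define Z where "Z = G * W"
    have YZ: "Y \<in> carrier_mat d d" "Z \<in> carrier_mat d d" using cs by (auto simp: Y_def Z_def)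
    define X where "X = D - of_real t \<cdot>\<^sub>m (G * W * G)"
    have X: "X \<in> carrier_mat d d" using cs by (simp add: X_def minus_carrier_mat)
    have Xh: "mat_adjoint X = X"
    proof -
      have "mat_adjoint (G * W * G) = G * (W * G)"
        using cs G W by (simp add: adjoint_mult[of _ d d _ d] psd_hermitian)
      then have GWG: "mat_adjoint (G * W * G) = G * W * G" using cs by (simp add: assoc)
      have "mat_adjoint (of_real t \<cdot>\<^sub>m (G * W * G)) = of_real t \<cdot>\<^sub>m mat_adjoint (G * W * G)"
        using cs by (intro eq_matI) auto
      then show ?thesis
        unfolding X_def using cs GWG by (simp add: adjoint_minus[of _ d d] D)
    qed
    have "X * K = D * K - of_real t \<cdot>\<^sub>m (G * W * G * K)"
      unfolding X_def using cs by (simp add: minus_mult_distrib_mat[of _ d d] mult_smult_assoc_mat[of _ d d])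
    also have "G * W * G * K = Z" using cs GK by (simp add: assoc Z_def)
    finally have XK: "X * K = Y - of_real t \<cdot>\<^sub>m Z" by (simp add: Y_def)
    have "psd d (mat_adjoint X * K * X)" using psd_conj[OF K X] .
    then have "0 \<le> tr (mat_adjoint X * K * X * K)" using tr_psd_mult_nonneg K by blast
    also have "mat_adjoint X * K * X * K = X * K * (X * K)" using X cs by (simp add: Xh assoc)
    also have "\<dots> = (Y * Y - of_real t \<cdot>\<^sub>m (Y * Z)) - (of_real t \<cdot>\<^sub>m (Z * Y) - of_real (t * t) \<cdot>\<^sub>m (Z * Z))"
      unfolding XK using YZ
      by (simp add: minus_mult_minus_mat[of _ d] mult_smult_assoc_mat[of _ d d _ d]
          mult_smult_distrib[of _ d d _ d] smult_smult_mat)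
    also have "tr \<dots> = tr (Y * Y) - of_real t * tr (Y * Z) - (of_real t * tr (Z * Y) - of_real (t * t) * tr (Z * Z))"
      using YZ by (simp add: tr_minus[of _ d] tr_smult[of _ d] minus_carrier_mat)
    also have "tr (Z * Y) = tr (Y * Z)" using YZ by (rule tr_cyclic[rotated])
    \<comment> \<open>The weights cancel in the cross term and leave \<open>tr (D * W)\<close>,
      twice the normalised trace norm, whatever \<open>K\<close> is.\<close>
    also have "Y * Z = D * ((K * G) * W)" using cs by (simp add: assoc Y_def Z_def)
    also have "\<dots> = D * W" using cs KG by simp
    finally have "0 \<le> p - 2 * t * a + t\<^sup>2 * q"
      by (simp add: p_def a_def q_def Y_def Z_def less_eq_complex_def power2_eq_square)
    also have "\<dots> \<le> p - 2 * t * a + t\<^sup>2 * g" using \<open>q \<le> g\<close> by (simp add: mult_left_mono)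
    finally show ?thesis .
  qed
  then have "a\<^sup>2 \<le> p * g" using g0 by (rule linear_quadratic_discriminant)
  then show ?thesis by (simp add: norm a_def p_def g_def power_divide)
qed

subsection \<open>Kronecker products\<close>

text \<open>An index of \<open>kron\<close> encodes a pair through \<open>div\<close> and
  \<open>mod\<close>; sums over such an index are products of sums only after this change of
  variables.\<close>

lemma sum_div_mod:
  fixes f :: "nat \<Rightarrow> nat \<Rightarrow> 'a :: comm_monoid_add"
  shows "(\<Sum>l<m * k. f (l div k) (l mod k)) = (\<Sum>a<m. \<Sum>b<k. f a b)"
proof -
  have "(\<Sum>a<m. \<Sum>b<k. f a b) = (\<Sum>(a, b)\<in>{..<m} \<times> {..<k}. f a b)"
    by (rule sum.cartesian_product)
  also have "\<dots> = (\<Sum>l<m * k. f (l div k) (l mod k))"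
  proof (rule sum.reindex_bij_witness[where j = "\<lambda>(a, b). a * k + b" and i = "\<lambda>l. (l div k, l mod k)"])
    fix l assume l: "l \<in> {..<m * k}"
    then have "k > 0" by (cases k) auto
    then show "(l div k, l mod k) \<in> {..<m} \<times> {..<k}"
      using l by (auto simp: less_mult_imp_div_less)
  next
    fix ab assume "ab \<in> {..<m} \<times> {..<k}"
    then obtain a b where ab: "ab = (a, b)" "a < m" "b < k" by auto
    then have "a * k + b < Suc a * k" by simp
    also have "\<dots> \<le> m * k" using ab by (intro mult_right_mono) auto
    finally show "(case ab of (a, b) \<Rightarrow> a * k + b) \<in> {..<m * k}" by (simp add: ab)
  qed auto
  finally show ?thesis by simp
qed

lemma kron_dim [simp]:
  "dim_row (A \<otimes>\<^sub>k B) = dim_row A * dim_row B" "dim_col (A \<otimes>\<^sub>k B) = dim_col A * dim_col B"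
  by (simp_all add: kron_def)

lemma kron_carrier [simp]:
  "A \<in> carrier_mat n m \<Longrightarrow> B \<in> carrier_mat k l \<Longrightarrow> A \<otimes>\<^sub>k B \<in> carrier_mat (n * k) (m * l)"
  by auto

lemma kron_index [simp]:
  "i < dim_row A * dim_row B \<Longrightarrow> j < dim_col A * dim_col B \<Longrightarrow>
    (A \<otimes>\<^sub>k B) $$ (i, j) = A $$ (i div dim_row B, j div dim_col B) * B $$ (i mod dim_row B, j mod dim_col B)"
  by (simp add: kron_def)

lemma mod_less_of_mult: "(i :: nat) < n * k \<Longrightarrow> i mod k < k"
  by (cases k) auto

lemma kron_mult:
  assumes "A \<in> carrier_mat n1 m1" "C \<in> carrier_mat m1 l1" "B \<in> carrier_mat n2 m2" "D \<in> carrier_mat m2 l2"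
  shows "(A \<otimes>\<^sub>k B) * (C \<otimes>\<^sub>k D) = (A * C) \<otimes>\<^sub>k (B * D)"
proof (rule eq_matI)
  fix i j assume "i < dim_row ((A * C) \<otimes>\<^sub>k (B * D))" "j < dim_col ((A * C) \<otimes>\<^sub>k (B * D))"
  then have ij: "i < n1 * n2" "j < l1 * l2" using assms by auto
  note lt = less_mult_imp_div_less[OF ij(1)] less_mult_imp_div_less[OF ij(2)]
    mod_less_of_mult[OF ij(1)] mod_less_of_mult[OF ij(2)]
  have "((A \<otimes>\<^sub>k B) * (C \<otimes>\<^sub>k D)) $$ (i, j) = (\<Sum>k<m1 * m2.
      (A $$ (i div n2, k div m2) * C $$ (k div m2, j div l2)) *
      (B $$ (i mod n2, k mod m2) * D $$ (k mod m2, j mod l2)))"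
    using assms ij by (auto simp: scalar_prod_def atLeast0LessThan mult_ac intro!: sum.cong)
  also have "\<dots> = (\<Sum>a<m1. A $$ (i div n2, a) * C $$ (a, j div l2)) * (\<Sum>b<m2. B $$ (i mod n2, b) * D $$ (b, j mod l2))"
    by (subst sum_div_mod[where f = "\<lambda>a b. (A $$ (i div n2, a) * C $$ (a, j div l2)) *
      (B $$ (i mod n2, b) * D $$ (b, j mod l2))"]) (simp add: sum_product)
  also have "\<dots> = ((A * C) \<otimes>\<^sub>k (B * D)) $$ (i, j)"
    using assms ij lt by (simp add: scalar_prod_def atLeast0LessThan)
  finally show "((A \<otimes>\<^sub>k B) * (C \<otimes>\<^sub>k D)) $$ (i, j) = ((A * C) \<otimes>\<^sub>k (B * D)) $$ (i, j)" .
qed (use assms in auto)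

lemma kron_adjoint: "mat_adjoint (A \<otimes>\<^sub>k B) = mat_adjoint A \<otimes>\<^sub>k mat_adjoint B"
proof (rule eq_matI)
  fix i j assume "i < dim_row (mat_adjoint A \<otimes>\<^sub>k mat_adjoint B)" "j < dim_col (mat_adjoint A \<otimes>\<^sub>k mat_adjoint B)"
  then have ij: "i < dim_col A * dim_col B" "j < dim_row A * dim_row B" by auto
  then show "mat_adjoint (A \<otimes>\<^sub>k B) $$ (i, j) = (mat_adjoint A \<otimes>\<^sub>k mat_adjoint B) $$ (i, j)"
    using less_mult_imp_div_less[OF ij(1)] less_mult_imp_div_less[OF ij(2)]
      mod_less_of_mult[OF ij(1)] mod_less_of_mult[OF ij(2)] by simp
qed auto

lemma tr_kron:
  assumes "A \<in> carrier_mat n n" "B \<in> carrier_mat m m"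
  shows "tr (A \<otimes>\<^sub>k B) = tr A * tr B"
proof -
  have "tr (A \<otimes>\<^sub>k B) = (\<Sum>k<n * m. A $$ (k div m, k div m) * B $$ (k mod m, k mod m))"
    using assms by (auto simp: tr_def)
  also have "\<dots> = tr A * tr B"
    using assms sum_div_mod[where f = "\<lambda>a b. A $$ (a, a) * B $$ (b, b)"] by (simp add: tr_def sum_product)
  finally show ?thesis .
qed

lemma kron_one: "1\<^sub>m n \<otimes>\<^sub>k 1\<^sub>m m = 1\<^sub>m (n * m)"
proof (rule eq_matI)
  fix i j assume "i < dim_row (1\<^sub>m (n * m))" "j < dim_col (1\<^sub>m (n * m))"
  then have ij: "i < n * m" "j < n * m" by auto
  moreover have "i div m = j div m \<and> i mod m = j mod m \<longleftrightarrow> i = j"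
    by (metis div_mult_mod_eq)
  ultimately show "(1\<^sub>m n \<otimes>\<^sub>k 1\<^sub>m m) $$ (i, j) = 1\<^sub>m (n * m) $$ (i, j)"
    using less_mult_imp_div_less[OF ij(1)] less_mult_imp_div_less[OF ij(2)]
      mod_less_of_mult[OF ij(1)] mod_less_of_mult[OF ij(2)] by auto
qed auto

text \<open>With positive roots \<open>P\<close> and \<open>Q\<close> of the factors, the product is
  the adjoint of \<open>P \<otimes>\<^sub>k Q\<close> times itself.\<close>

lemma psd_kron:
  assumes A: "psd n A" and B: "psd m B"
  shows "psd (n * m) (A \<otimes>\<^sub>k B)"
proof -
  obtain P where P: "psd n P" "P * P = A" using psd_sqrt_exists[OF A] .
  obtain Q where Q: "psd m Q" "Q * Q = B" using psd_sqrt_exists[OF B] .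
  note c = psd_carrier[OF P(1)] psd_carrier[OF Q(1)]
  have "A \<otimes>\<^sub>k B = mat_adjoint (P \<otimes>\<^sub>k Q) * (P \<otimes>\<^sub>k Q)"
    using c P Q by (simp add: kron_adjoint psd_hermitian kron_mult[of _ n n _ n _ m m _ m])
  then show ?thesis using psd_adjoint_mult_self[of "P \<otimes>\<^sub>k Q" "n * m" "n * m"] c by simp
qed

subsection \<open>Sums of matrices\<close>

lemma sum_mat_carrier [simp]: "sum_mat d F S \<in> carrier_mat d d"
  by (simp add: sum_mat_def)

lemma sum_mat_dim [simp]: "dim_row (sum_mat d F S) = d" "dim_col (sum_mat d F S) = d"
  by (simp_all add: sum_mat_def)

lemma sum_mat_index [simp]: "i < d \<Longrightarrow> j < d \<Longrightarrow> sum_mat d F S $$ (i, j) = (\<Sum>s\<in>S. F s $$ (i, j))"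
  by (simp add: sum_mat_def)

lemma sum_mat_cong: "(\<And>s. s \<in> S \<Longrightarrow> F s = G s) \<Longrightarrow> sum_mat d F S = sum_mat d G S"
  by (simp add: sum_mat_def)

lemma tr_sum_mat:
  assumes "\<And>s. s \<in> S \<Longrightarrow> F s \<in> carrier_mat d d"
  shows "tr (sum_mat d F S) = (\<Sum>s\<in>S. tr (F s))"
proof -
  have "tr (sum_mat d F S) = (\<Sum>s\<in>S. \<Sum>i<d. F s $$ (i, i))"
    by (simp add: tr_def sum.swap[of _ _ S])
  also have "\<dots> = (\<Sum>s\<in>S. tr (F s))"
    using assms by (intro sum.cong) (auto simp: tr_def)
  finally show ?thesis .
qed

lemma sum_mat_mult:
  assumes "\<And>s. s \<in> S \<Longrightarrow> F s \<in> carrier_mat d d" "B \<in> carrier_mat d d"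
  shows "sum_mat d F S * B = sum_mat d (\<lambda>s. F s * B) S"
proof (rule eq_matI)
  fix i j assume "i < dim_row (sum_mat d (\<lambda>s. F s * B) S)" "j < dim_col (sum_mat d (\<lambda>s. F s * B) S)"
  then have ij: "i < d" "j < d" by auto
  have "(sum_mat d F S * B) $$ (i, j) = (\<Sum>k<d. \<Sum>s\<in>S. F s $$ (i, k) * B $$ (k, j))"
    using assms ij by (auto simp: scalar_prod_def atLeast0LessThan sum_distrib_right)
  also have "\<dots> = (\<Sum>s\<in>S. \<Sum>k<d. F s $$ (i, k) * B $$ (k, j))" by (rule sum.swap)
  also have "\<dots> = (\<Sum>s\<in>S. (F s * B) $$ (i, j))"
    using assms(2) ij by (intro sum.cong) (auto simp: scalar_prod_def atLeast0LessThan carrier_matD[OF assms(1)])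
  finally show "(sum_mat d F S * B) $$ (i, j) = sum_mat d (\<lambda>s. F s * B) S $$ (i, j)" using ij by simp
qed (use assms in auto)

lemma mult_sum_mat:
  assumes "\<And>s. s \<in> S \<Longrightarrow> F s \<in> carrier_mat d d" "B \<in> carrier_mat d d"
  shows "B * sum_mat d F S = sum_mat d (\<lambda>s. B * F s) S"
proof (rule eq_matI)
  fix i j assume "i < dim_row (sum_mat d (\<lambda>s. B * F s) S)" "j < dim_col (sum_mat d (\<lambda>s. B * F s) S)"
  then have ij: "i < d" "j < d" by auto
  have "(B * sum_mat d F S) $$ (i, j) = (\<Sum>k<d. \<Sum>s\<in>S. B $$ (i, k) * F s $$ (k, j))"
    using assms ij by (auto simp: scalar_prod_def atLeast0LessThan sum_distrib_left)
  also have "\<dots> = (\<Sum>s\<in>S. \<Sum>k<d. B $$ (i, k) * F s $$ (k, j))" by (rule sum.swap)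
  also have "\<dots> = (\<Sum>s\<in>S. (B * F s) $$ (i, j))"
    using assms(2) ij by (intro sum.cong) (auto simp: scalar_prod_def atLeast0LessThan carrier_matD[OF assms(1)])
  finally show "(B * sum_mat d F S) $$ (i, j) = sum_mat d (\<lambda>s. B * F s) S $$ (i, j)" using ij by simp
qed (use assms in auto)

lemma adjoint_sum_mat:
  assumes "\<And>s. s \<in> S \<Longrightarrow> F s \<in> carrier_mat d d"
  shows "mat_adjoint (sum_mat d F S) = sum_mat d (\<lambda>s. mat_adjoint (F s)) S"
proof (rule eq_matI)
  fix i j assume "i < dim_row (sum_mat d (\<lambda>s. mat_adjoint (F s)) S)" "j < dim_col (sum_mat d (\<lambda>s. mat_adjoint (F s)) S)"
  then have ij: "i < d" "j < d" by auto
  have "cnj (\<Sum>s\<in>S. F s $$ (j, i)) = (\<Sum>s\<in>S. mat_adjoint (F s) $$ (i, j))"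
    unfolding cnj_sum using ij by (intro sum.cong) (auto simp: carrier_matD[OF assms])
  then show "mat_adjoint (sum_mat d F S) $$ (i, j) = sum_mat d (\<lambda>s. mat_adjoint (F s)) S $$ (i, j)"
    using ij by simp
qed auto

lemma tr_sum_mat_mult_sum_mat:
  assumes F: "\<And>s. s \<in> S \<Longrightarrow> F s \<in> carrier_mat d d"
  shows "tr (sum_mat d F S * sum_mat d F S) = (\<Sum>s\<in>S. \<Sum>t\<in>S. tr (F s * F t))"
proof -
  have "tr (sum_mat d F S * sum_mat d F S) = (\<Sum>s\<in>S. tr (F s * sum_mat d F S))"
    using F by (subst sum_mat_mult) (auto simp: tr_sum_mat)
  also have "\<dots> = (\<Sum>s\<in>S. \<Sum>t\<in>S. tr (F s * F t))"
    using F by (intro sum.cong) (auto simp: mult_sum_mat[where d = d] tr_sum_mat)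
  finally show ?thesis .
qed

subsection \<open>Guessing entropy and the pretty good measurement\<close>

lemma finite_bits [simp]: "finite (bits n)"
  using finite_lists_length_eq[of "UNIV :: bool set" n] by (simp add: bits_def)

lemma card_bits: "card (bits n) = 2 ^ n"
  using card_lists_length_eq[of "UNIV :: bool set" n] by (simp add: bits_def)

text \<open>Groups a sum by the value of \<open>g\<close>; it will merge the measurement outcomes
  that lead to the same guess.\<close>

lemma sum_fibres:
  assumes "finite A" "g \<in> A \<rightarrow> A"
  shows "(\<Sum>z\<in>A. \<Sum>x\<in>{x \<in> A. g x = z}. h z x) = (\<Sum>x\<in>A. h (g x) x)"
proof -
  have "(\<Sum>z\<in>A. \<Sum>x\<in>{x \<in> A. g x = z}. h z x) = (\<Sum>z\<in>A. \<Sum>x\<in>{x \<in> A. g x = z}. h (g x) x)"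
    by (intro sum.cong) auto
  also have "\<dots> = (\<Sum>x\<in>A. h (g x) x)" using assms by (intro sum.group) auto
  finally show ?thesis .
qed

lemma expectation_bit_source:
  fixes f :: "bool list \<Rightarrow> real"
  assumes "bit_source n X"
  shows "measure_pmf.expectation X f = (\<Sum>x\<in>bits n. pmf X x * f x)"
  using assms by (subst integral_measure_pmf[of "bits n"]) (auto simp: bit_source_def)

lemma sum_pmf_bits:
  assumes "bit_source n X"
  shows "(\<Sum>x\<in>bits n. pmf X x) = 1"
  using expectation_bit_source[OF assms, of "\<lambda>_. 1"] by simp

text \<open>All elements of the measurement together contribute \<open>tr \<rho> = 1\<close>, and
  those other than \<open>M x\<close> contribute a nonnegative amount. This keeps the supremum in
  \<open>guessing_entropy\<close> bounded.\<close>

lemma povm_success_le_1: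
  assumes M: "povm d (bits n) M" and \<rho>: "density d \<rho>" and x: "x \<in> bits n"
  shows "Re (tr (M x * \<rho>)) \<le> 1"
proof -
  have psd: "psd d (M z)" if "z \<in> bits n" for z using M that by (simp add: povm_def)
  have c: "M x \<in> carrier_mat d d" "\<rho> \<in> carrier_mat d d"
    using psd[OF x] \<rho> psd_carrier by (auto simp: density_def)
  have split: "sum_mat d M (bits n) = M x + sum_mat d M (bits n - {x})"
    using c x by (intro eq_matI) (auto simp: sum.remove[OF finite_bits x])
  have "\<rho> = (M x + sum_mat d M (bits n - {x})) * \<rho>"
    using M c by (simp add: povm_def flip: split)
  also have "\<dots> = M x * \<rho> + sum_mat d M (bits n - {x}) * \<rho>"
    using c by (simp add: add_mult_distrib_mat[of _ d d])
  finally have "tr \<rho> = tr (M x * \<rho>) + tr (sum_mat d M (bits n - {x}) * \<rho>)"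
    using c tr_add[of "M x * \<rho>" d "sum_mat d M (bits n - {x}) * \<rho>"] by simp
  moreover have "0 \<le> tr (sum_mat d M (bits n - {x}) * \<rho>)"
    using psd \<rho> by (intro tr_psd_mult_nonneg[of d] psd_sum_mat) (auto simp: density_def)
  ultimately show ?thesis
    using \<rho> by (simp add: density_def less_eq_complex_def complex_eq_iff)
qed

text \<open>Guessing at random without looking at the state, which succeeds with probability
  \<open>1 / 2 ^ n\<close>.\<close>

lemma povm_uniform: "povm d (bits n) (\<lambda>_. complex_of_real (1 / 2 ^ n) \<cdot>\<^sub>m 1\<^sub>m d)"
  unfolding povm_def
proof (intro conjI ballI psd_smult psd_one)
  show "sum_mat d (\<lambda>_. complex_of_real (1 / 2 ^ n) \<cdot>\<^sub>m 1\<^sub>m d) (bits n) = 1\<^sub>m d"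
    by (intro eq_matI) (auto simp: card_bits)
qed auto

lemma guessing_success_le:
  assumes X: "bit_source n X" and \<rho>: "\<And>x. x \<in> bits n \<Longrightarrow> density d (\<rho> x)"
    and k: "guessing_entropy n d X \<rho> \<ge> k" and M: "povm d (bits n) M"
  shows "(\<Sum>x\<in>bits n. pmf X x * Re (tr (M x * \<rho> x))) \<le> 2 powr (- k)"
proof -
  define s where "s M = measure_pmf.expectation X (\<lambda>x. Re (tr (M x * \<rho> x)))" for M
  have s: "s M = (\<Sum>x\<in>bits n. pmf X x * Re (tr (M x * \<rho> x)))" for M
    unfolding s_def by (rule expectation_bit_source[OF X])
  define S where "S = (SUP M\<in>{M. povm d (bits n) M}. s M)"
  have le1: "s M \<le> 1" if "povm d (bits n) M" for M
  proof -
    have "s M \<le> (\<Sum>x\<in>bits n. pmf X x * 1)"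
      unfolding s using povm_success_le_1[OF that \<rho>] by (intro sum_mono mult_left_mono) auto
    then show ?thesis using sum_pmf_bits[OF X] by simp
  qed
  have upper: "s M \<le> S" if "povm d (bits n) M" for M
    unfolding S_def using that le1 by (intro cSUP_upper) (auto intro!: bdd_aboveI2)
  have "s (\<lambda>_. complex_of_real (1 / 2 ^ n) \<cdot>\<^sub>m 1\<^sub>m d) = (\<Sum>x\<in>bits n. pmf X x * (1 / 2 ^ n))"
    unfolding s
  proof (rule sum.cong)
    fix x assume "x \<in> bits n"
    then have "\<rho> x \<in> carrier_mat d d" "tr (\<rho> x) = 1"
      using \<rho>[of x] psd_carrier by (auto simp: density_def)
    then have "tr (complex_of_real (1 / 2 ^ n) \<cdot>\<^sub>m 1\<^sub>m d * \<rho> x) = complex_of_real (1 / 2 ^ n)"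
      by (simp add: mult_smult_assoc_mat[of _ d d] tr_smult[of _ d])
    then show "pmf X x * Re (tr (complex_of_real (1 / 2 ^ n) \<cdot>\<^sub>m 1\<^sub>m d * \<rho> x)) = pmf X x * (1 / 2 ^ n)"
      by simp
  qed simp
  also have "\<dots> > 0" using sum_pmf_bits[OF X] by (simp flip: sum_divide_distrib)
  \<comment> \<open>Only for a positive supremum does the bound on \<open>log 2 S\<close> translate
    back into a bound on \<open>S\<close>.\<close>
  finally have "S > 0" using upper[OF povm_uniform] by linarith
  moreover have "log 2 S \<le> - k"
    using k unfolding guessing_entropy_def S_def s_def by simp
  ultimately have "S \<le> 2 powr (- k)" by (simp add: le_powr_iff)
  then show ?thesis using upper[OF M] by (simp add: s)
qed

section \<open>The pretty good measurement of a shifted average state\<close>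

text \<open>An average state may be singular; raising all eigenvalues by \<open>\<delta>\<close>
  makes its root invertible, with root and inverse diagonal in the eigenbasis of
  \<open>R\<close>.\<close>

lemma psd_sqrt_inverse_shift:
  assumes R: "psd d R" and \<delta>: "\<delta> > 0"
  obtains G K where "psd d G" "psd d K" "G * K = 1\<^sub>m d" "K * G = 1\<^sub>m d"
    "G * G = R + complex_of_real \<delta> \<cdot>\<^sub>m 1\<^sub>m d"
proof -
  obtain U f where U: "unitary_mat d U" and R: "R = spectral_mat d U f" and f: "\<And>i. i < d \<Longrightarrow> f i \<ge> 0"
    using psd_spectral_mat[OF R] by blast
  \<comment> \<open>The absolute value makes \<open>g\<close> positive at every index, including
    those from \<open>d\<close> on, where nothing is known about \<open>f\<close>.\<close>
  define g where "g i = sqrt (\<bar>f i\<bar> + \<delta>)" for i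
  have g: "g i > 0" "g i * g i = \<bar>f i\<bar> + \<delta>" for i
    using \<delta> by (auto simp: g_def add_nonneg_pos)
  show thesis
  proof (rule that)
    show "psd d (spectral_mat d U g)" "psd d (spectral_mat d U (\<lambda>i. 1 / g i))"
      using g(1) by (auto intro!: spectral_mat_psd U simp: less_imp_le)
    have "g i \<noteq> 0" for i using g(1)[of i] by simp
    then show "spectral_mat d U g * spectral_mat d U (\<lambda>i. 1 / g i) = 1\<^sub>m d"
      "spectral_mat d U (\<lambda>i. 1 / g i) * spectral_mat d U g = 1\<^sub>m d"
      using U by (simp_all add: spectral_mat_mult spectral_mat_one)
    let ?D = "mat_diag d (\<lambda>i. complex_of_real (f i))"
    have Uc: "U \<in> carrier_mat d d" "mat_adjoint U \<in> carrier_mat d d" "U * mat_adjoint U = 1\<^sub>m d"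
      using U by (auto simp: unitary_mat_def)
    have "mat_diag d (\<lambda>i. complex_of_real (\<bar>f i\<bar> + \<delta>)) = ?D + complex_of_real \<delta> \<cdot>\<^sub>m 1\<^sub>m d"
      using f by (intro eq_matI) (auto simp: mat_diag_def)
    then have "spectral_mat d U (\<lambda>i. \<bar>f i\<bar> + \<delta>)
        = U * (?D + complex_of_real \<delta> \<cdot>\<^sub>m 1\<^sub>m d) * mat_adjoint U"
      unfolding spectral_mat_def by (rule arg_cong)
    then have "spectral_mat d U g * spectral_mat d U g
        = U * (?D + complex_of_real \<delta> \<cdot>\<^sub>m 1\<^sub>m d) * mat_adjoint U"
      unfolding spectral_mat_mult[OF U] g(2) .
    also have "\<dots> = R + complex_of_real \<delta> \<cdot>\<^sub>m (U * mat_adjoint U)"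
      unfolding R spectral_mat_def using Uc(1,2)
      by (simp add: mult_add_distrib_mat[of _ d d _ d] add_mult_distrib_mat[of _ d d _ _ d]
          mult_smult_distrib[of _ d d _ d] mult_smult_assoc_mat[of _ d d _ d])
    finally show "spectral_mat d U g * spectral_mat d U g = R + complex_of_real \<delta> \<cdot>\<^sub>m 1\<^sub>m d"
      by (simp add: Uc(3))
  qed
qed

text \<open>The operators \<open>p(x) K \<rho>\<^sub>x K\<close> form an approximate pretty good measurement; the shift of the
  average state by \<open>\<delta>\<close> makes it invertible.\<close>

lemma pretty_good_measurement:
  assumes X: "bit_source n X" and \<rho>: "\<And>x. x \<in> bits n \<Longrightarrow> density d (\<rho> x)"
    and k: "guessing_entropy n d X \<rho> \<ge> k" and \<delta>: "\<delta> > 0"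
  obtains G K where "psd d G" "psd d K" "G * K = 1\<^sub>m d" "K * G = 1\<^sub>m d"
    "Re (tr (G * G)) = 1 + \<delta> * real d"
    "\<And>x x'. x \<in> bits n \<Longrightarrow> x' \<in> bits n \<Longrightarrow> 0 \<le> tr (\<rho> x * K * (\<rho> x' * K))"
    "(\<Sum>x\<in>bits n. \<Sum>x'\<in>bits n. pmf X x * pmf X x' * Re (tr (\<rho> x * K * (\<rho> x' * K)))) \<le> 1"
    "\<And>g. g \<in> bits n \<rightarrow> bits n \<Longrightarrow>
      (\<Sum>x\<in>bits n. pmf X (g x) * pmf X x * Re (tr (\<rho> (g x) * K * (\<rho> x * K)))) \<le> 2 powr (- k)"
proof -
  have psd\<rho>: "psd d (\<rho> x)" and c\<rho>: "\<rho> x \<in> carrier_mat d d" and tr\<rho>: "tr (\<rho> x) = 1"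
    if "x \<in> bits n" for x
    using \<rho>[OF that] psd_carrier by (auto simp: density_def)
  define p where "p x = complex_of_real (pmf X x)" for x
  define R where "R = sum_mat d (\<lambda>x. p x \<cdot>\<^sub>m \<rho> x) (bits n)"
  have R: "psd d R" unfolding R_def p_def by (intro psd_sum_mat psd_smult psd\<rho>) auto
  have Rc: "R \<in> carrier_mat d d" by (simp add: R_def)
  have sump: "(\<Sum>x\<in>bits n. p x) = 1"
    using sum_pmf_bits[OF X] by (simp add: p_def flip: of_real_sum)
  have trR: "tr R = 1"
    unfolding R_def using c\<rho> tr\<rho> sump by (simp add: tr_sum_mat tr_smult[of _ d])
  obtain G K where GK: "psd d G" "psd d K" "G * K = 1\<^sub>m d" "K * G = 1\<^sub>m d"
    and GG: "G * G = R + complex_of_real \<delta> \<cdot>\<^sub>m 1\<^sub>m d"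
    using psd_sqrt_inverse_shift[OF R \<delta>] by blast
  note c = psd_carrier[OF GK(1)] psd_carrier[OF GK(2)]
  note assoc = assoc_mult_mat[of _ d d _ d _ d]
  have trGG: "Re (tr (G * G)) = 1 + \<delta> * real d"
    unfolding GG using Rc by (simp add: tr_add[of _ d] tr_smult[of _ d] trR)
  have psdK\<rho>K: "psd d (K * \<rho> x * K)" if "x \<in> bits n" for x
    using psd_conj[OF psd\<rho>[OF that] c(2)] by (simp add: psd_hermitian[OF GK(2)])
  have psdKK: "psd d (complex_of_real \<delta> \<cdot>\<^sub>m (K * K))"
    using psd_smult[OF psd_adjoint_mult_self[OF c(2)], of \<delta>] \<delta> by (simp add: psd_hermitian[OF GK(2)])
  have tr_swap: "tr (\<rho> x * K * (\<rho> x' * K)) = tr ((K * \<rho> x' * K) * \<rho> x)" if "x \<in> bits n" "x' \<in> bits n" for x x'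
  proof -
    have "tr (\<rho> x * K * (\<rho> x' * K)) = tr (\<rho> x * (K * \<rho> x' * K))"
      using c\<rho> that c by (simp add: assoc)
    also have "\<dots> = tr ((K * \<rho> x' * K) * \<rho> x)" using c\<rho> that c by (intro tr_cyclic[of _ d d]) auto
    finally show ?thesis .
  qed
  have nonneg: "0 \<le> tr (\<rho> x * K * (\<rho> x' * K))" if "x \<in> bits n" "x' \<in> bits n" for x x'
    unfolding tr_swap[OF that] using that by (intro tr_psd_mult_nonneg[of d] psdK\<rho>K psd\<rho>)
  \<comment> \<open>Since \<open>K * (R + \<delta>) * K = K * G * G * K = 1\<close>, the pretty good
    operators miss the identity by exactly \<open>\<delta> K\<^sup>2\<close>.\<close>
  have KRK: "sum_mat d (\<lambda>x. p x \<cdot>\<^sub>m (K * \<rho> x * K)) (bits n) + complex_of_real \<delta> \<cdot>\<^sub>m (K * K) = 1\<^sub>m d"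
  proof -
    have "sum_mat d (\<lambda>x. p x \<cdot>\<^sub>m (K * \<rho> x * K)) (bits n) = sum_mat d (\<lambda>x. K * (p x \<cdot>\<^sub>m \<rho> x) * K) (bits n)"
      using c c\<rho> by (intro sum_mat_cong) (simp add: mult_smult_distrib[of _ d d _ d] mult_smult_assoc_mat[of _ d d _ d])
    also have "\<dots> = K * R * K"
      unfolding R_def using c c\<rho> by (simp add: sum_mat_mult mult_sum_mat[where d = d])
    finally have "sum_mat d (\<lambda>x. p x \<cdot>\<^sub>m (K * \<rho> x * K)) (bits n) + complex_of_real \<delta> \<cdot>\<^sub>m (K * K)
        = K * R * K + complex_of_real \<delta> \<cdot>\<^sub>m (K * 1\<^sub>m d * K)" using c by simp
    also have "\<dots> = K * (R + complex_of_real \<delta> \<cdot>\<^sub>m 1\<^sub>m d) * K"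
      using Rc c by (simp add: mult_add_distrib_mat[of _ d d _ d] add_mult_distrib_mat[of _ d d _ _ d]
          mult_smult_distrib[of _ d d _ d] mult_smult_assoc_mat[of _ d d _ d])
    also have "\<dots> = (K * G) * (G * K)" unfolding GG[symmetric] using c by (simp add: assoc)
    also have "\<dots> = 1\<^sub>m d" using GK by simp
    finally show ?thesis .
  qed
  have total: "(\<Sum>x\<in>bits n. \<Sum>x'\<in>bits n. pmf X x * pmf X x' * Re (tr (\<rho> x * K * (\<rho> x' * K)))) \<le> 1"
  proof -
    \<comment> \<open>For each fixed state the outcome weights fall short of one by the nonnegative
      share of the remainder \<open>\<delta> K\<^sup>2\<close>.\<close>
    have row: "(\<Sum>x'\<in>bits n. pmf X x' * Re (tr (\<rho> x * K * (\<rho> x' * K)))) \<le> 1" if x: "x \<in> bits n" for x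
    proof -
      have "\<rho> x = (sum_mat d (\<lambda>x. p x \<cdot>\<^sub>m (K * \<rho> x * K)) (bits n) + complex_of_real \<delta> \<cdot>\<^sub>m (K * K)) * \<rho> x"
        unfolding KRK using c\<rho>[OF x] by simp
      also have "\<dots> = sum_mat d (\<lambda>x. p x \<cdot>\<^sub>m (K * \<rho> x * K)) (bits n) * \<rho> x + complex_of_real \<delta> \<cdot>\<^sub>m (K * K) * \<rho> x"
        using c c\<rho>[OF x] by (intro add_mult_distrib_mat) auto
      also have "sum_mat d (\<lambda>x. p x \<cdot>\<^sub>m (K * \<rho> x * K)) (bits n) * \<rho> x
          = sum_mat d (\<lambda>x'. p x' \<cdot>\<^sub>m (K * \<rho> x' * K * \<rho> x)) (bits n)"
        using c c\<rho> x by (subst sum_mat_mult) (auto intro!: sum_mat_cong simp: mult_smult_assoc_mat[of _ d d _ d])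
      finally have "1 = tr (sum_mat d (\<lambda>x'. p x' \<cdot>\<^sub>m (K * \<rho> x' * K * \<rho> x)) (bits n) + complex_of_real \<delta> \<cdot>\<^sub>m (K * K) * \<rho> x)"
        using tr\<rho>[OF x] by simp
      also have "\<dots> = (\<Sum>x'\<in>bits n. p x' * tr (\<rho> x * K * (\<rho> x' * K))) + tr (complex_of_real \<delta> \<cdot>\<^sub>m (K * K) * \<rho> x)"
        using c c\<rho> x by (simp add: tr_add[of _ d] tr_sum_mat tr_smult[of _ d] tr_swap)
      finally have "1 = (\<Sum>x'\<in>bits n. pmf X x' * Re (tr (\<rho> x * K * (\<rho> x' * K)))) + Re (tr (complex_of_real \<delta> \<cdot>\<^sub>m (K * K) * \<rho> x))"
        by (simp add: complex_eq_iff p_def)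
      moreover have "0 \<le> tr (complex_of_real \<delta> \<cdot>\<^sub>m (K * K) * \<rho> x)"
        using psdKK psd\<rho>[OF x] by (rule tr_psd_mult_nonneg)
      ultimately show ?thesis by (simp add: less_eq_complex_def)
    qed
    have "(\<Sum>x\<in>bits n. \<Sum>x'\<in>bits n. pmf X x * pmf X x' * Re (tr (\<rho> x * K * (\<rho> x' * K))))
        = (\<Sum>x\<in>bits n. pmf X x * (\<Sum>x'\<in>bits n. pmf X x' * Re (tr (\<rho> x * K * (\<rho> x' * K)))))"
      by (simp add: sum_distrib_left mult_ac)
    also have "\<dots> \<le> (\<Sum>x\<in>bits n. pmf X x * 1)" by (intro sum_mono mult_left_mono row) auto
    finally show ?thesis using sum_pmf_bits[OF X] by simp
  qed
  \<comment> \<open>Here \<open>x\<close> is a measurement outcome and \<open>g x\<close> the value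
    guessed from it. Merging the outcomes with equal guess gives a measurement whose success the
    guessing entropy bounds.\<close>
  have guess: "(\<Sum>x\<in>bits n. pmf X (g x) * pmf X x * Re (tr (\<rho> (g x) * K * (\<rho> x * K)))) \<le> 2 powr (- k)"
    if g: "g \<in> bits n \<rightarrow> bits n" for g
  proof -
    define z0 where "z0 = replicate n False"
    have z0: "z0 \<in> bits n" by (simp add: z0_def bits_def)
    define B where "B z = {x \<in> bits n. g x = z}" for z
    have finB: "finite (B z)" for z by (simp add: B_def)
    define N where "N z = sum_mat d (\<lambda>x. p x \<cdot>\<^sub>m (K * \<rho> x * K)) (B z)" for z
    \<comment> \<open>The remainder goes to an arbitrary guess \<open>z0\<close>: it completes the
      measurement and can only raise the success probability.\<close>
    define r where "r z = complex_of_real (if z = z0 then \<delta> else 0)" for z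
    define M where "M z = N z + r z \<cdot>\<^sub>m (K * K)" for z
    have Nc: "N z \<in> carrier_mat d d" for z by (simp add: N_def)
    have psdr: "psd d (r z \<cdot>\<^sub>m (K * K))" for z
      unfolding r_def using psd_smult[OF psd_adjoint_mult_self[OF c(2)]] \<delta> by (simp add: psd_hermitian[OF GK(2)])
    note reindex = sum_fibres[OF finite_bits g, folded B_def]
    have "sum_mat d M (bits n) = sum_mat d (\<lambda>x. p x \<cdot>\<^sub>m (K * \<rho> x * K)) (bits n) + complex_of_real \<delta> \<cdot>\<^sub>m (K * K)"
    proof (rule eq_matI)
      fix i j assume "i < dim_row (sum_mat d (\<lambda>x. p x \<cdot>\<^sub>m (K * \<rho> x * K)) (bits n) + complex_of_real \<delta> \<cdot>\<^sub>m (K * K))"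
        "j < dim_col (sum_mat d (\<lambda>x. p x \<cdot>\<^sub>m (K * \<rho> x * K)) (bits n) + complex_of_real \<delta> \<cdot>\<^sub>m (K * K))"
      then have ij: "i < d" "j < d" using c by auto
      have "sum_mat d M (bits n) $$ (i, j) = (\<Sum>z\<in>bits n. N z $$ (i, j) + r z * (K * K) $$ (i, j))"
        using ij c Nc by (simp add: M_def del: index_mult_mat(1))
      also have "\<dots> = (\<Sum>z\<in>bits n. \<Sum>x\<in>B z. (p x \<cdot>\<^sub>m (K * \<rho> x * K)) $$ (i, j)) + (\<Sum>z\<in>bits n. r z) * (K * K) $$ (i, j)"
        using ij by (simp add: N_def sum.distrib sum_distrib_right del: index_mult_mat(1) index_smult_mat)
      also have "(\<Sum>z\<in>bits n. r z) = complex_of_real \<delta>"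
        using z0 by (simp add: r_def if_distrib[of complex_of_real] cong: if_cong)
      also have "(\<Sum>z\<in>bits n. \<Sum>x\<in>B z. (p x \<cdot>\<^sub>m (K * \<rho> x * K)) $$ (i, j))
          = sum_mat d (\<lambda>x. p x \<cdot>\<^sub>m (K * \<rho> x * K)) (bits n) $$ (i, j)"
        unfolding reindex using ij by (simp del: index_mult_mat(1) index_smult_mat)
      finally show "sum_mat d M (bits n) $$ (i, j)
          = (sum_mat d (\<lambda>x. p x \<cdot>\<^sub>m (K * \<rho> x * K)) (bits n) + complex_of_real \<delta> \<cdot>\<^sub>m (K * K)) $$ (i, j)"
        using ij c by (simp del: index_mult_mat(1))
    qed (use c in auto)
    then have "sum_mat d M (bits n) = 1\<^sub>m d" unfolding KRK .
    moreover have "psd d (M z)" for z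
      unfolding M_def N_def p_def
      by (auto intro!: psd_add psd_sum_mat psd_smult psdK\<rho>K psdr simp: B_def)
    ultimately have "povm d (bits n) M" by (simp add: povm_def)
    then have le: "(\<Sum>z\<in>bits n. pmf X z * Re (tr (M z * \<rho> z))) \<le> 2 powr (- k)"
      by (intro guessing_success_le[OF X _ k] \<rho>)
    have "(\<Sum>x\<in>bits n. pmf X (g x) * pmf X x * Re (tr (\<rho> (g x) * K * (\<rho> x * K))))
        = (\<Sum>z\<in>bits n. \<Sum>x\<in>B z. pmf X z * pmf X x * Re (tr (\<rho> z * K * (\<rho> x * K))))"
      by (rule reindex[symmetric])
    also have "\<dots> \<le> (\<Sum>z\<in>bits n. pmf X z * Re (tr (M z * \<rho> z)))"
    proof (rule sum_mono)
      fix z assume z: "z \<in> bits n"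
      have "M z * \<rho> z = N z * \<rho> z + r z \<cdot>\<^sub>m (K * K) * \<rho> z"
        unfolding M_def using Nc c c\<rho>[OF z] by (intro add_mult_distrib_mat[of _ d d]) auto
      also have "N z * \<rho> z = sum_mat d (\<lambda>x. p x \<cdot>\<^sub>m (K * \<rho> x * K * \<rho> z)) (B z)"
        unfolding N_def using c c\<rho> z
        by (subst sum_mat_mult) (auto intro!: sum_mat_cong simp: mult_smult_assoc_mat[of _ d d _ d] B_def)
      finally have "tr (M z * \<rho> z) = tr (sum_mat d (\<lambda>x. p x \<cdot>\<^sub>m (K * \<rho> x * K * \<rho> z)) (B z)) + tr (r z \<cdot>\<^sub>m (K * K) * \<rho> z)"
        using c c\<rho>[OF z] by (simp add: tr_add[of _ d])
      also have "tr (sum_mat d (\<lambda>x. p x \<cdot>\<^sub>m (K * \<rho> x * K * \<rho> z)) (B z)) = (\<Sum>x\<in>B z. tr (p x \<cdot>\<^sub>m (K * \<rho> x * K * \<rho> z)))"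
        using c c\<rho> z by (intro tr_sum_mat) (auto simp: B_def)
      also have "\<dots> = (\<Sum>x\<in>B z. p x * tr (\<rho> z * K * (\<rho> x * K)))"
        using c c\<rho> z by (intro sum.cong) (auto simp: B_def tr_smult[of _ d] tr_swap)
      finally have "tr (M z * \<rho> z) = (\<Sum>x\<in>B z. p x * tr (\<rho> z * K * (\<rho> x * K))) + tr (r z \<cdot>\<^sub>m (K * K) * \<rho> z)" .
      moreover have "0 \<le> tr (r z \<cdot>\<^sub>m (K * K) * \<rho> z)" using psdr psd\<rho>[OF z] by (rule tr_psd_mult_nonneg)
      ultimately have "(\<Sum>x\<in>B z. pmf X x * Re (tr (\<rho> z * K * (\<rho> x * K)))) \<le> Re (tr (M z * \<rho> z))"
        by (simp add: less_eq_complex_def p_def)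
      then have "pmf X z * (\<Sum>x\<in>B z. pmf X x * Re (tr (\<rho> z * K * (\<rho> x * K)))) \<le> pmf X z * Re (tr (M z * \<rho> z))"
        by (rule mult_left_mono) simp
      then show "(\<Sum>x\<in>B z. pmf X z * pmf X x * Re (tr (\<rho> z * K * (\<rho> x * K)))) \<le> pmf X z * Re (tr (M z * \<rho> z))"
        by (simp add: sum_distrib_left mult_ac)
    qed
    also note le
    finally show ?thesis .
  qed
  show thesis by (rule that[OF GK trGG nonneg total guess])
qed

subsection \<open>Classical side information\<close>

text \<open>The character \<open>(-1)^z\<close> of a bit. As \<open>[False]\<close> labels basis
  vector 0, it agrees with the diagonal of \<open>sign_mat\<close>.\<close>

definition bit_sign :: "bool list \<Rightarrow> real" where
  "bit_sign z = (if z = [False] then 1 else - 1)"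

lemma abs_bit_sign [simp]: "\<bar>bit_sign z\<bar> = 1"
  by (simp add: bit_sign_def)

lemma bits_1: "bits 1 = {[False], [True]}"
  by (auto simp: bits_def length_Suc_conv)

text \<open>For one bit the expected sign is a difference of two deviations from
  \<open>1 / 2\<close>, and their absolute values add up to twice the variational distance.\<close>

lemma extractor_bias_le:
  assumes E: "two_source_extractor n 1 k1 k2 \<epsilon> E"
    and X: "bit_source n X" "has_min_entropy X k1" and Y: "bit_source n Y" "has_min_entropy Y k2"
  shows "\<bar>\<Sum>x\<in>bits n. \<Sum>y\<in>bits n. pmf X x * pmf Y y * bit_sign (E x y)\<bar> \<le> 2 * \<epsilon>"
proof -
  define P where "P = map_pmf (\<lambda>(x, y). E x y) (pair_pmf X Y)"
  have Eb: "E x y \<in> bits 1" if "x \<in> bits n" "y \<in> bits n" for x y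
    using E that unfolding two_source_extractor_def by blast
  have vd: "variational_distance (bits 1) P (pmf_of_set (bits 1)) \<le> \<epsilon>"
    using E X Y unfolding two_source_extractor_def P_def by blast
  have half: "pmf (pmf_of_set (bits 1)) z = 1 / 2" if "z \<in> bits 1" for z
    using that by (subst pmf_of_set) (auto simp: card_bits)
  have "(\<Sum>x\<in>bits n. \<Sum>y\<in>bits n. pmf X x * pmf Y y * bit_sign (E x y))
      = (\<Sum>(x, y)\<in>bits n \<times> bits n. pmf (pair_pmf X Y) (x, y) * bit_sign (E x y))"
    by (simp add: sum.cartesian_product pmf_pair)
  also have "\<dots> = measure_pmf.expectation (pair_pmf X Y) (\<lambda>(x, y). bit_sign (E x y))"
    using X(1) Y(1) by (subst integral_measure_pmf[of "bits n \<times> bits n"])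
      (auto simp: bit_source_def case_prod_unfold intro!: sum.cong)
  also have "\<dots> = measure_pmf.expectation P bit_sign"
    by (simp add: P_def case_prod_unfold)
  also have "\<dots> = (\<Sum>z\<in>bits 1. pmf P z * bit_sign z)"
    using X(1) Y(1) Eb by (subst integral_measure_pmf[of "bits 1"])
      (auto simp: P_def bit_source_def subset_iff)
  also have "\<dots> = (pmf P [False] - 1 / 2) - (pmf P [True] - 1 / 2)"
    unfolding bits_1 by (simp add: bit_sign_def)
  also have "\<bar>\<dots>\<bar> \<le> \<bar>pmf P [False] - 1 / 2\<bar> + \<bar>pmf P [True] - 1 / 2\<bar>"
    by (rule abs_triangle_ineq4)
  also have "\<dots> = 2 * variational_distance (bits 1) P (pmf_of_set (bits 1))"
    using half[of "[False]"] half[of "[True]"] unfolding variational_distance_def bits_1 by simp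
  also have "\<dots> \<le> 2 * \<epsilon>" using vd by simp
  finally show ?thesis .
qed

text \<open>Homogeneous form of the bias bound. Conditional distributions will appear as
  unnormalised columns of a joint weight, some of which may vanish, so both sides scale with the
  masses.\<close>

lemma extractor_bias_weights_le:
  assumes E: "two_source_extractor n 1 k1 k2 \<epsilon> E"
    and a: "\<And>x. x \<in> bits n \<Longrightarrow> 0 \<le> a x" "\<And>x. x \<in> bits n \<Longrightarrow> a x \<le> 2 powr (- k1) * (\<Sum>x\<in>bits n. a x)"
    and b: "\<And>y. y \<in> bits n \<Longrightarrow> 0 \<le> b y" "\<And>y. y \<in> bits n \<Longrightarrow> b y \<le> 2 powr (- k2) * (\<Sum>y\<in>bits n. b y)"
  shows "\<bar>\<Sum>x\<in>bits n. \<Sum>y\<in>bits n. a x * b y * bit_sign (E x y)\<bar>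
    \<le> 2 * \<epsilon> * (\<Sum>x\<in>bits n. a x) * (\<Sum>y\<in>bits n. b y)"
proof (cases "(\<Sum>x\<in>bits n. a x) = 0 \<or> (\<Sum>y\<in>bits n. b y) = 0")
  case True
  then have "(\<forall>x\<in>bits n. a x = 0) \<or> (\<forall>y\<in>bits n. b y = 0)"
    using a(1) b(1) by (subst (asm) (1 2) sum_nonneg_eq_0_iff) auto
  then show ?thesis using True by auto
next
  case False
  define u where "u = (\<Sum>x\<in>bits n. a x)"
  define v where "v = (\<Sum>y\<in>bits n. b y)"
  have uv: "u > 0" "v > 0"
    using False a(1) b(1) sum_nonneg[of "bits n" a] sum_nonneg[of "bits n" b] by (auto simp: u_def v_def less_le)
  \<comment> \<open>Dividing by the total mass \<open>w\<close> gives a distribution, and the bound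
    relative to \<open>w\<close> becomes the min-entropy condition.\<close>
  have source: "\<exists>Z. bit_source n Z \<and> has_min_entropy Z k \<and> (\<forall>x\<in>bits n. pmf Z x = c x / w)"
    if c: "\<And>x. x \<in> bits n \<Longrightarrow> 0 \<le> c x" "\<And>x. x \<in> bits n \<Longrightarrow> c x \<le> 2 powr (- k) * w"
      and w: "w = (\<Sum>x\<in>bits n. c x)" "w > 0" for c k w
  proof -
    define h where "h x = (if x \<in> bits n then c x / w else 0)" for x
    have h0: "h x \<ge> 0" for x using c w by (simp add: h_def)
    have "(\<integral>\<^sup>+ x. ennreal (h x) \<partial>count_space UNIV) = (\<integral>\<^sup>+ x. ennreal (h x) \<partial>count_space (bits n))"
      by (rule nn_integral_count_space_eq) (auto simp: h_def)
    also have "\<dots> = ennreal (\<Sum>x\<in>bits n. h x)"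
      using h0 by (simp add: nn_integral_count_space_finite sum_ennreal)
    also have "(\<Sum>x\<in>bits n. h x) = 1"
      using w by (simp add: h_def flip: sum_divide_distrib)
    finally have pmf: "pmf (embed_pmf h) x = h x" for x
      using h0 by (intro pmf_embed_pmf) auto
    have "bit_source n (embed_pmf h)"
      unfolding bit_source_def by (auto simp: set_pmf_eq pmf h_def)
    moreover have "has_min_entropy (embed_pmf h) k"
      using c(2) w(2) by (auto simp: has_min_entropy_def pmf h_def divide_le_eq)
    ultimately show ?thesis by (intro exI[of _ "embed_pmf h"]) (simp add: pmf h_def)
  qed
  obtain X where X: "bit_source n X" "has_min_entropy X k1" "\<And>x. x \<in> bits n \<Longrightarrow> pmf X x = a x / u"
    using source[of a k1 u] a uv by (auto simp: u_def)
  obtain Y where Y: "bit_source n Y" "has_min_entropy Y k2" "\<And>y. y \<in> bits n \<Longrightarrow> pmf Y y = b y / v"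
    using source[of b k2 v] b uv by (auto simp: v_def)
  have "(\<Sum>x\<in>bits n. \<Sum>y\<in>bits n. a x * b y * bit_sign (E x y))
      = (\<Sum>x\<in>bits n. \<Sum>y\<in>bits n. u * v * (pmf X x * pmf Y y * bit_sign (E x y)))"
    using uv by (intro sum.cong) (auto simp: X(3) Y(3))
  also have "\<dots> = u * v * (\<Sum>x\<in>bits n. \<Sum>y\<in>bits n. pmf X x * pmf Y y * bit_sign (E x y))"
    by (simp add: sum_distrib_left)
  also have "\<bar>\<dots>\<bar> = u * v * \<bar>\<Sum>x\<in>bits n. \<Sum>y\<in>bits n. pmf X x * pmf Y y * bit_sign (E x y)\<bar>"
    using uv by (simp add: abs_mult)
  also have "\<dots> \<le> u * v * (2 * \<epsilon>)"
    using uv extractor_bias_le[OF E X(1,2) Y(1,2)] by (intro mult_left_mono) auto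
  finally show ?thesis by (simp add: u_def v_def mult_ac)
qed

text \<open>Markov's inequality in guessing form: on each bad outcome \<open>g\<close> names a value
  that violates the bound, so \<open>g\<close> succeeds with weight at least
  \<open>2 powr (- k)\<close> times the bad mass.\<close>

lemma low_entropy_weight_le:
  fixes J :: "bool list \<Rightarrow> bool list \<Rightarrow> real"
  assumes nonneg: "\<And>x x'. x \<in> bits n \<Longrightarrow> x' \<in> bits n \<Longrightarrow> 0 \<le> J x x'"
    and guess: "\<And>g. g \<in> bits n \<rightarrow> bits n \<Longrightarrow> (\<Sum>x'\<in>bits n. J (g x') x') \<le> \<epsilon> * 2 powr (- k)"
  defines "w \<equiv> \<lambda>x'. \<Sum>x\<in>bits n. J x x'"
  shows "(\<Sum>x'\<in>bits n. if \<forall>x\<in>bits n. J x x' \<le> 2 powr (- k) * w x' then 0 else w x') \<le> \<epsilon>"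
proof -
  define good where "good x' \<longleftrightarrow> (\<forall>x\<in>bits n. J x x' \<le> 2 powr (- k) * w x')" for x'
  \<comment> \<open>The default on good outcomes only has to lie in \<open>bits n\<close>, where its
    weight is nonnegative.\<close>
  define g where "g x' = (if good x' then replicate n False
      else SOME x. x \<in> bits n \<and> J x x' > 2 powr (- k) * w x')" for x'
  have bad: "g x' \<in> bits n \<and> J (g x') x' > 2 powr (- k) * w x'" if "\<not> good x'" for x'
  proof -
    have "\<exists>x. x \<in> bits n \<and> J x x' > 2 powr (- k) * w x'"
      using that by (auto simp: good_def not_le)
    from someI_ex[OF this] show ?thesis using that by (simp add: g_def)
  qed
  have g: "g \<in> bits n \<rightarrow> bits n"
  proof
    fix x' show "g x' \<in> bits n" using bad[of x'] by (cases "good x'") (auto simp: g_def bits_def)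
  qed
  have "2 powr (- k) * (\<Sum>x'\<in>bits n. if good x' then 0 else w x') \<le> (\<Sum>x'\<in>bits n. J (g x') x')"
    unfolding sum_distrib_left
  proof (rule sum_mono)
    fix x' assume x': "x' \<in> bits n"
    then show "2 powr (- k) * (if good x' then 0 else w x') \<le> J (g x') x'"
      using bad[of x'] nonneg[of "g x'" x'] g by auto
  qed
  also have "\<dots> \<le> 2 powr (- k) * \<epsilon>" using guess[OF g] by (simp add: mult.commute)
  finally show ?thesis unfolding good_def by simp
qed

text \<open>In \<open>J1 x x'\<close> the source value comes first and the side information second.
  Fixing \<open>x'\<close> and \<open>y'\<close> leaves a product weight, to which the extractor
  applies if both columns have enough min-entropy; other pairs get the trivial bound, charged to the
  low-entropy mass.\<close>

lemma extractor_classical_side_information: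
  fixes J1 J2 :: "bool list \<Rightarrow> bool list \<Rightarrow> real"
  assumes E: "two_source_extractor n 1 k1 k2 \<epsilon> E" and \<epsilon>: "\<epsilon> \<ge> 0"
    and nonneg1: "\<And>x x'. x \<in> bits n \<Longrightarrow> x' \<in> bits n \<Longrightarrow> 0 \<le> J1 x x'"
    and total1: "(\<Sum>x\<in>bits n. \<Sum>x'\<in>bits n. J1 x x') \<le> 1"
    and guess1: "\<And>g. g \<in> bits n \<rightarrow> bits n \<Longrightarrow> (\<Sum>x'\<in>bits n. J1 (g x') x') \<le> \<epsilon> * 2 powr (- k1)"
    and nonneg2: "\<And>x x'. x \<in> bits n \<Longrightarrow> x' \<in> bits n \<Longrightarrow> 0 \<le> J2 x x'"
    and total2: "(\<Sum>x\<in>bits n. \<Sum>x'\<in>bits n. J2 x x') \<le> 1"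
    and guess2: "\<And>g. g \<in> bits n \<rightarrow> bits n \<Longrightarrow> (\<Sum>x'\<in>bits n. J2 (g x') x') \<le> \<epsilon> * 2 powr (- k2)"
  shows "(\<Sum>x'\<in>bits n. \<Sum>y'\<in>bits n. bit_sign (E x' y') *
      (\<Sum>x\<in>bits n. \<Sum>y\<in>bits n. J1 x x' * J2 y y' * bit_sign (E x y))) \<le> 4 * \<epsilon>"
proof -
  define w1 where "w1 x' = (\<Sum>x\<in>bits n. J1 x x')" for x'
  define w2 where "w2 y' = (\<Sum>y\<in>bits n. J2 y y')" for y'
  define b1 where "b1 x' = (if \<forall>x\<in>bits n. J1 x x' \<le> 2 powr (- k1) * w1 x' then 0 else w1 x')" for x'
  define b2 where "b2 y' = (if \<forall>y\<in>bits n. J2 y y' \<le> 2 powr (- k2) * w2 y' then 0 else w2 y')" for y'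
  define A where "A x' y' = (\<Sum>x\<in>bits n. \<Sum>y\<in>bits n. J1 x x' * J2 y y' * bit_sign (E x y))" for x' y'
  have w0: "w1 x \<ge> 0" "w2 x \<ge> 0" if "x \<in> bits n" for x
    using nonneg1 nonneg2 that by (auto simp: w1_def w2_def intro!: sum_nonneg)
  have b0: "b1 x \<ge> 0" "b2 x \<ge> 0" if "x \<in> bits n" for x
    using w0[OF that] by (auto simp: b1_def b2_def)
  have sumw: "(\<Sum>x\<in>bits n. w1 x) \<le> 1" "(\<Sum>y\<in>bits n. w2 y) \<le> 1"
    using total1 total2 unfolding w1_def w2_def by (subst sum.swap; simp)+
  have sumb: "(\<Sum>x\<in>bits n. b1 x) \<le> \<epsilon>" "(\<Sum>y\<in>bits n. b2 y) \<le> \<epsilon>"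
    unfolding b1_def b2_def w1_def w2_def
    using low_entropy_weight_le[OF nonneg1 guess1] low_entropy_weight_le[OF nonneg2 guess2] by auto
  have A: "\<bar>A x' y'\<bar> \<le> 2 * \<epsilon> * (w1 x' * w2 y') + b1 x' * w2 y' + w1 x' * b2 y'"
    if x': "x' \<in> bits n" and y': "y' \<in> bits n" for x' y'
  proof (cases "(\<forall>x\<in>bits n. J1 x x' \<le> 2 powr (- k1) * w1 x') \<and> (\<forall>y\<in>bits n. J2 y y' \<le> 2 powr (- k2) * w2 y')")
    case True
    have "\<bar>A x' y'\<bar> \<le> 2 * \<epsilon> * w1 x' * w2 y'"
      unfolding A_def w1_def w2_def
      using True nonneg1 nonneg2 x' y' by (intro extractor_bias_weights_le[OF E]) (auto simp: w1_def w2_def)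
    then show ?thesis using w0 b0 x' y' by (simp add: mult.assoc add_increasing2)
  next
    case False
    have "\<bar>A x' y'\<bar> \<le> (\<Sum>x\<in>bits n. \<Sum>y\<in>bits n. \<bar>J1 x x' * J2 y y' * bit_sign (E x y)\<bar>)"
      unfolding A_def by (intro order.trans[OF sum_abs] sum_mono sum_abs)
    also have "\<dots> = (\<Sum>x\<in>bits n. \<Sum>y\<in>bits n. J1 x x' * J2 y y')"
      using nonneg1 nonneg2 x' y' by (intro sum.cong) (auto simp: abs_mult)
    also have "\<dots> = w1 x' * w2 y'" by (simp add: w1_def w2_def sum_product)
    \<comment> \<open>At such a pair \<open>b1 x' = w1 x'\<close> or \<open>b2 y' = w2 y'\<close>,
      so one summand alone covers the trivial bound.\<close>
    also have "\<dots> \<le> b1 x' * w2 y' + w1 x' * b2 y'"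
      using False w0[OF x'] w0[OF y'] b0[OF x'] b0[OF y'] unfolding b1_def b2_def by auto
    also have "\<dots> \<le> 2 * \<epsilon> * (w1 x' * w2 y') + (b1 x' * w2 y' + w1 x' * b2 y')"
      using \<epsilon> w0 x' y' by simp
    finally show ?thesis by simp
  qed
  \<comment> \<open>The outer sign is a function of the side information alone and enters only
    through its absolute value.\<close>
  have "(\<Sum>x'\<in>bits n. \<Sum>y'\<in>bits n. bit_sign (E x' y') * A x' y') \<le> (\<Sum>x'\<in>bits n. \<Sum>y'\<in>bits n. \<bar>A x' y'\<bar>)"
  proof (intro sum_mono)
    fix x' y' show "bit_sign (E x' y') * A x' y' \<le> \<bar>A x' y'\<bar>"
      using abs_ge_self[of "bit_sign (E x' y') * A x' y'"] by (simp add: abs_mult)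
  qed
  also have "\<dots> \<le> (\<Sum>x'\<in>bits n. \<Sum>y'\<in>bits n. 2 * \<epsilon> * (w1 x' * w2 y') + b1 x' * w2 y' + w1 x' * b2 y')"
    by (intro sum_mono A)
  also have "\<dots> = 2 * \<epsilon> * ((\<Sum>x\<in>bits n. w1 x) * (\<Sum>y\<in>bits n. w2 y))
      + (\<Sum>x\<in>bits n. b1 x) * (\<Sum>y\<in>bits n. w2 y) + (\<Sum>x\<in>bits n. w1 x) * (\<Sum>y\<in>bits n. b2 y)"
    by (simp add: sum.distrib flip: sum_distrib_left sum_distrib_right)
  \<comment> \<open>Bias \<open>2 * \<epsilon>\<close> on good pairs, plus \<open>\<epsilon>\<close>
    for the bad outcomes of each source.\<close>
  also have "\<dots> \<le> 2 * \<epsilon> * (1 * 1) + \<epsilon> * 1 + 1 * \<epsilon>"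
    using sumw sumb \<epsilon> w0 b0 by (intro add_mono mult_mono mult_left_mono) (auto intro!: sum_nonneg)
  finally show ?thesis by (simp add: A_def)
qed

subsection \<open>The XOR form of the error\<close>

definition sign_mat :: "complex mat" where
  "sign_mat = mat_diag 2 (\<lambda>i. if i = 0 then 1 else - 1)"

lemma sign_mat_carrier [simp]: "sign_mat \<in> carrier_mat 2 2"
  by (simp add: sign_mat_def)

lemma sign_mat_hermitian: "mat_adjoint sign_mat = sign_mat"
  unfolding sign_mat_def adjoint_mat_diag by (rule arg_cong[where f = "mat_diag 2"]) auto

lemma sign_mat_square: "sign_mat * sign_mat = 1\<^sub>m 2"
proof -
  have "(\<lambda>i :: nat. (if i = 0 then 1 else - 1) * (if i = 0 then 1 else - 1 :: complex)) = (\<lambda>_. 1)" by auto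
  then show ?thesis unfolding sign_mat_def mat_diag_diag by simp
qed

lemma basis_proj_carrier: "z \<in> bits m \<Longrightarrow> basis_proj z \<in> carrier_mat (2 ^ m) (2 ^ m)"
  by (auto simp: basis_proj_def bits_def Let_def)

text \<open>With a single output bit the two projectors deviate from the mixed state by opposite
  multiples of one matrix, so the value of \<open>E\<close> enters the error only as a scalar
  sign.\<close>

lemma basis_proj_minus_mixed:
  assumes "z \<in> bits 1" "i < 2" "j < 2"
  shows "basis_proj z $$ (i, j) - maximally_mixed 2 $$ (i, j) = of_real (bit_sign z / 2) * sign_mat $$ (i, j)"
proof -
  have "i = 0 \<or> i = 1" "j = 0 \<or> j = 1" using assms by auto
  then show ?thesis using assms(1) unfolding bits_1
    by (auto simp: basis_proj_def maximally_mixed_def sign_mat_def mat_diag_def bit_sign_def)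
qed

text \<open>Both terms carry the same factor on the side information, so for each \<open>x\<close>
  and \<open>y\<close> the difference concerns the output bit alone.\<close>

lemma extractor_error_eq:
  assumes E: "\<And>x y. x \<in> bits n \<Longrightarrow> y \<in> bits n \<Longrightarrow> E x y \<in> bits 1"
    and \<rho>: "\<And>x. x \<in> bits n \<Longrightarrow> \<rho> x \<in> carrier_mat d1 d1"
    and \<sigma>: "\<And>y. y \<in> bits n \<Longrightarrow> \<sigma> y \<in> carrier_mat d2 d2"
  shows "sum_mat (2 ^ 1 * (d1 * d2)) (\<lambda>(x, y). of_real (p x y) \<cdot>\<^sub>m (basis_proj (E x y) \<otimes>\<^sub>k \<rho> x \<otimes>\<^sub>k \<sigma> y)) (bits n \<times> bits n)
      - maximally_mixed (2 ^ 1) \<otimes>\<^sub>k sum_mat (d1 * d2) (\<lambda>(x, y). of_real (p x y) \<cdot>\<^sub>m (\<rho> x \<otimes>\<^sub>k \<sigma> y)) (bits n \<times> bits n)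
    = sum_mat (2 * (d1 * d2)) (\<lambda>(x, y). of_real (p x y * bit_sign (E x y) / 2) \<cdot>\<^sub>m (sign_mat \<otimes>\<^sub>k \<rho> x \<otimes>\<^sub>k \<sigma> y)) (bits n \<times> bits n)"
    (is "?L - maximally_mixed (2 ^ 1) \<otimes>\<^sub>k ?R = ?F")
proof (rule eq_matI)
  let ?N = "d1 * d2"
  have mm: "maximally_mixed (2 ^ 1) \<in> carrier_mat 2 2" by (simp add: maximally_mixed_def)
  fix i j assume "i < dim_row ?F" "j < dim_col ?F"
  then have ij: "i < 2 * ?N" "j < 2 * ?N" by auto
  note lt = less_mult_imp_div_less[OF ij(1)] less_mult_imp_div_less[OF ij(2)]
    mod_less_of_mult[OF ij(1)] mod_less_of_mult[OF ij(2)]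
  have "(?L - maximally_mixed (2 ^ 1) \<otimes>\<^sub>k ?R) $$ (i, j)
      = (\<Sum>(x, y)\<in>bits n \<times> bits n. of_real (p x y) * (basis_proj (E x y) $$ (i div ?N, j div ?N) * (\<rho> x \<otimes>\<^sub>k \<sigma> y) $$ (i mod ?N, j mod ?N)))
      - maximally_mixed 2 $$ (i div ?N, j div ?N) * (\<Sum>(x, y)\<in>bits n \<times> bits n. of_real (p x y) * (\<rho> x \<otimes>\<^sub>k \<sigma> y) $$ (i mod ?N, j mod ?N))"
  proof -
    have "?L $$ (i, j) = (\<Sum>(x, y)\<in>bits n \<times> bits n. of_real (p x y) * (basis_proj (E x y) $$ (i div ?N, j div ?N) * (\<rho> x \<otimes>\<^sub>k \<sigma> y) $$ (i mod ?N, j mod ?N)))"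
      using ij unfolding sum_mat_def
      by (auto intro!: sum.cong simp del: kron_index)
        (auto simp: kron_index[of _ "basis_proj _" "_ \<otimes>\<^sub>k _"] carrier_matD[OF basis_proj_carrier[OF E]] carrier_matD[OF \<rho>] carrier_matD[OF \<sigma>])
    moreover have "(maximally_mixed (2 ^ 1) \<otimes>\<^sub>k ?R) $$ (i, j)
        = maximally_mixed 2 $$ (i div ?N, j div ?N) * (\<Sum>(x, y)\<in>bits n \<times> bits n. of_real (p x y) * (\<rho> x \<otimes>\<^sub>k \<sigma> y) $$ (i mod ?N, j mod ?N))"
    proof -
      have "?R $$ (i mod ?N, j mod ?N) = (\<Sum>(x, y)\<in>bits n \<times> bits n. of_real (p x y) * (\<rho> x \<otimes>\<^sub>k \<sigma> y) $$ (i mod ?N, j mod ?N))"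
        using lt by (auto intro!: sum.cong simp: carrier_matD[OF \<rho>] carrier_matD[OF \<sigma>] simp del: kron_index)
      then show ?thesis using ij mm by simp
    qed
    ultimately show ?thesis using ij mm by simp
  qed
  also have "\<dots> = (\<Sum>(x, y)\<in>bits n \<times> bits n. of_real (p x y) *
      ((basis_proj (E x y) $$ (i div ?N, j div ?N) - maximally_mixed 2 $$ (i div ?N, j div ?N)) * (\<rho> x \<otimes>\<^sub>k \<sigma> y) $$ (i mod ?N, j mod ?N)))"
    unfolding sum_distrib_left sum_subtractf[symmetric]
    by (intro sum.cong) (auto simp: algebra_simps)
  also have "\<dots> = (\<Sum>(x, y)\<in>bits n \<times> bits n. of_real (p x y) *
      (of_real (bit_sign (E x y) / 2) * sign_mat $$ (i div ?N, j div ?N) * (\<rho> x \<otimes>\<^sub>k \<sigma> y) $$ (i mod ?N, j mod ?N)))"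
    using lt E by (intro sum.cong refl) (auto simp: basis_proj_minus_mixed simp del: kron_index)
  also have "\<dots> = ?F $$ (i, j)"
    using ij unfolding sum_mat_def
    by (auto intro!: sum.cong simp del: kron_index)
      (auto simp: kron_index[of _ sign_mat "_ \<otimes>\<^sub>k _"] carrier_matD[OF sign_mat_carrier] carrier_matD[OF \<rho>] carrier_matD[OF \<sigma>])
  finally show "(?L - maximally_mixed (2 ^ 1) \<otimes>\<^sub>k ?R) $$ (i, j) = ?F $$ (i, j)" .
qed (auto simp: maximally_mixed_def)

lemma psd_kron3:
  assumes "psd d1 A" "psd d2 B"
  shows "psd (2 * (d1 * d2)) (1\<^sub>m 2 \<otimes>\<^sub>k A \<otimes>\<^sub>k B)"
  using assms by (intro psd_kron psd_one)

lemma kron3_mult: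
  assumes "Z \<in> carrier_mat 2 2" "Z' \<in> carrier_mat 2 2" "A \<in> carrier_mat d1 d1" "A' \<in> carrier_mat d1 d1"
    "B \<in> carrier_mat d2 d2" "B' \<in> carrier_mat d2 d2"
  shows "(Z \<otimes>\<^sub>k A \<otimes>\<^sub>k B) * (Z' \<otimes>\<^sub>k A' \<otimes>\<^sub>k B') = (Z * Z') \<otimes>\<^sub>k (A * A') \<otimes>\<^sub>k (B * B')"
  using assms by (subst kron_mult[of _ 2 2 _ 2 _ "d1 * d2" "d1 * d2" _ "d1 * d2"])
    (auto simp: kron_mult[of _ d1 d1 _ d1 _ d2 d2 _ d2])

lemma tr_kron3:
  assumes "Z \<in> carrier_mat 2 2" "A \<in> carrier_mat d1 d1" "B \<in> carrier_mat d2 d2"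
  shows "tr (Z \<otimes>\<^sub>k A \<otimes>\<^sub>k B) = tr Z * tr A * tr B"
  using assms by (simp add: tr_kron[of _ 2 _ "d1 * d2"] tr_kron[of _ d1 _ d2])

theorem corollary25:
  fixes n :: nat and k1 k2 \<epsilon> :: real and E :: "bool list \<Rightarrow> bool list \<Rightarrow> bool list"
  assumes "\<epsilon> > 0"
    and "two_source_extractor n 1 k1 k2 \<epsilon> E"
  shows "quantum_two_source_extractor n 1 (k1 + log 2 (1 / \<epsilon>)) (k2 + log 2 (1 / \<epsilon>)) (sqrt (3 * \<epsilon> / 2)) E"
  unfolding quantum_two_source_extractor_def
proof (intro conjI allI impI)
  show EP: "E \<in> bits n \<rightarrow> bits n \<rightarrow> bits 1"
    using assms(2) by (simp add: two_source_extractor_def)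
  fix X Y d1 d2 \<rho> \<sigma>
  assume X: "bit_source n X" and Y: "bit_source n Y"
    and "\<forall>x\<in>bits n. density d1 (\<rho> x)" "\<forall>y\<in>bits n. density d2 (\<sigma> y)"
    and gX: "k1 + log 2 (1 / \<epsilon>) \<le> guessing_entropy n d1 X \<rho>"
    and gY: "k2 + log 2 (1 / \<epsilon>) \<le> guessing_entropy n d2 Y \<sigma>"
  then have \<rho>: "density d1 (\<rho> x)" if "x \<in> bits n" for x using that by blast
  have \<sigma>: "density d2 (\<sigma> y)" if "y \<in> bits n" for y
    using \<open>\<forall>y\<in>bits n. density d2 (\<sigma> y)\<close> that by blast
  have \<rho>c: "\<rho> x \<in> carrier_mat d1 d1" and \<rho>h: "mat_adjoint (\<rho> x) = \<rho> x" if "x \<in> bits n" for x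
    using \<rho>[OF that] psd_carrier psd_hermitian by (auto simp: density_def)
  have \<sigma>c: "\<sigma> y \<in> carrier_mat d2 d2" and \<sigma>h: "mat_adjoint (\<sigma> y) = \<sigma> y" if "y \<in> bits n" for y
    using \<sigma>[OF that] psd_carrier psd_hermitian by (auto simp: density_def)
  \<comment> \<open>The 0 by 0 matrix has trace 0, so it is no density matrix; the shift
    \<open>1 / (5 d)\<close> needs \<open>d\<close> positive.\<close>
  have pos: "d > 0" if "density d R" for d R
  proof (rule ccontr)
    assume "\<not> d > 0"
    with that have "R \<in> carrier_mat 0 0" "tr R = 1" using psd_carrier by (auto simp: density_def)
    then show False by (simp add: tr_def)
  qed
  have z: "replicate n False \<in> bits n" by (simp add: bits_def)
  have d: "d1 > 0" "d2 > 0" using pos[OF \<rho>[OF z]] pos[OF \<sigma>[OF z]] by auto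
  \<comment> \<open>The extra entropy turns into the factor \<open>\<epsilon>\<close> that the
    Markov argument requires.\<close>
  have powr: "2 powr (- (k + log 2 (1 / \<epsilon>))) = \<epsilon> * 2 powr (- k)" for k
  proof -
    have "2 powr (- (k + log 2 (1 / \<epsilon>))) = 2 powr (log 2 \<epsilon> + (- k))"
      using assms(1) by (simp add: log_divide)
    then show ?thesis using assms(1) by (simp only: powr_add) simp
  qed

  txt \<open>The shifts by \<open>1 / (5 d)\<close> cost a factor \<open>(6 / 5)\<^sup>2 = 36 / 25 \<le> 3 / 2\<close> in the final bound.\<close>
  obtain G1 K1 where G1: "psd d1 G1" "psd d1 K1" "G1 * K1 = 1\<^sub>m d1" "K1 * G1 = 1\<^sub>m d1"
    and trG1: "Re (tr (G1 * G1)) = 1 + 1 / (5 * real d1) * real d1"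
    and nonneg1: "\<And>x x'. x \<in> bits n \<Longrightarrow> x' \<in> bits n \<Longrightarrow> 0 \<le> tr (\<rho> x * K1 * (\<rho> x' * K1))"
    and total1: "(\<Sum>x\<in>bits n. \<Sum>x'\<in>bits n. pmf X x * pmf X x' * Re (tr (\<rho> x * K1 * (\<rho> x' * K1)))) \<le> 1"
    and guess1: "\<And>g. g \<in> bits n \<rightarrow> bits n \<Longrightarrow>
      (\<Sum>x\<in>bits n. pmf X (g x) * pmf X x * Re (tr (\<rho> (g x) * K1 * (\<rho> x * K1)))) \<le> 2 powr (- (k1 + log 2 (1 / \<epsilon>)))"
    by (rule pretty_good_measurement[OF X \<rho> gX, of "1 / (5 * real d1)"]) (use d in auto)
  obtain G2 K2 where G2: "psd d2 G2" "psd d2 K2" "G2 * K2 = 1\<^sub>m d2" "K2 * G2 = 1\<^sub>m d2"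
    and trG2: "Re (tr (G2 * G2)) = 1 + 1 / (5 * real d2) * real d2"
    and nonneg2: "\<And>y y'. y \<in> bits n \<Longrightarrow> y' \<in> bits n \<Longrightarrow> 0 \<le> tr (\<sigma> y * K2 * (\<sigma> y' * K2))"
    and total2: "(\<Sum>y\<in>bits n. \<Sum>y'\<in>bits n. pmf Y y * pmf Y y' * Re (tr (\<sigma> y * K2 * (\<sigma> y' * K2)))) \<le> 1"
    and guess2: "\<And>g. g \<in> bits n \<rightarrow> bits n \<Longrightarrow>
      (\<Sum>y\<in>bits n. pmf Y (g y) * pmf Y y * Re (tr (\<sigma> (g y) * K2 * (\<sigma> y * K2)))) \<le> 2 powr (- (k2 + log 2 (1 / \<epsilon>)))"
    by (rule pretty_good_measurement[OF Y \<sigma> gY, of "1 / (5 * real d2)"]) (use d in auto)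
  note c = psd_carrier[OF G1(1)] psd_carrier[OF G1(2)] psd_carrier[OF G2(1)] psd_carrier[OF G2(2)]

  let ?N = "2 * (d1 * d2)"
  let ?S = "bits n \<times> bits n"
  \<comment> \<open>The weight factorises over the systems, so the correlation splits into
    \<open>J1\<close> and \<open>J2\<close>; the output bit gets the identity.\<close>
  define G where "G = 1\<^sub>m 2 \<otimes>\<^sub>k G1 \<otimes>\<^sub>k G2"
  define K where "K = 1\<^sub>m 2 \<otimes>\<^sub>k K1 \<otimes>\<^sub>k K2"
  have G: "psd ?N G" and K: "psd ?N K" unfolding G_def K_def using G1 G2 by (auto intro!: psd_kron3)
  have Kc: "K \<in> carrier_mat ?N ?N" using K by (rule psd_carrier)
  have GK: "G * K = 1\<^sub>m ?N" and KG: "K * G = 1\<^sub>m ?N"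
    unfolding G_def K_def using c G1 G2 by (simp_all add: kron3_mult[of _ _ _ d1 _ _ d2] kron_one)
  \<comment> \<open>\<open>2 * (6 / 5)\<^sup>2\<close>: a factor 2 from the output bit and
    \<open>6 / 5\<close> from each shifted average state.\<close>
  have trGG: "Re (tr (G * G)) = 72 / 25"
  proof -
    have "tr (G * G) = 2 * tr (G1 * G1) * tr (G2 * G2)"
      unfolding G_def using c by (simp add: kron3_mult[of _ _ _ d1 _ _ d2] tr_kron3[of _ _ d1 _ d2])
    moreover have "0 \<le> tr (G1 * G1)" "0 \<le> tr (G2 * G2)"
      using G1 G2 by (auto intro: tr_psd_mult_nonneg)
    ultimately have "Re (tr (G * G)) = 2 * Re (tr (G1 * G1)) * Re (tr (G2 * G2))"
      by (simp add: less_eq_complex_def)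
    moreover have "Re (tr (G1 * G1)) = 6 / 5" "Re (tr (G2 * G2)) = 6 / 5" using d trG1 trG2 by simp_all
    ultimately show ?thesis by simp
  qed

  define s where "s a = pmf X (fst a) * pmf Y (snd a) * bit_sign (E (fst a) (snd a)) / 2" for a
  define V where "V a = sign_mat \<otimes>\<^sub>k \<rho> (fst a) \<otimes>\<^sub>k \<sigma> (snd a)" for a
  define D where "D = sum_mat ?N (\<lambda>a. complex_of_real (s a) \<cdot>\<^sub>m V a) ?S"
  have Vc: "V a \<in> carrier_mat ?N ?N" if "a \<in> ?S" for a
    using that \<rho>c \<sigma>c by (auto simp: V_def)
  have Vh: "mat_adjoint (V a) = V a" if "a \<in> ?S" for a
    using that \<rho>h \<sigma>h by (auto simp: V_def kron_adjoint sign_mat_hermitian)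
  have Dc: "D \<in> carrier_mat ?N ?N" by (simp add: D_def)
  have "mat_adjoint D = sum_mat ?N (\<lambda>a. mat_adjoint (complex_of_real (s a) \<cdot>\<^sub>m V a)) ?S"
    unfolding D_def using Vc by (intro adjoint_sum_mat) simp
  also have "\<dots> = D"
    unfolding D_def
  proof (rule sum_mat_cong)
    fix a assume a: "a \<in> ?S"
    have "mat_adjoint (complex_of_real (s a) \<cdot>\<^sub>m V a) = complex_of_real (s a) \<cdot>\<^sub>m mat_adjoint (V a)"
      using Vc[OF a] by (intro eq_matI) auto
    then show "mat_adjoint (complex_of_real (s a) \<cdot>\<^sub>m V a) = complex_of_real (s a) \<cdot>\<^sub>m V a"
      by (simp add: Vh[OF a])
  qed
  finally have Dh: "mat_adjoint D = D" .

  \<comment> \<open>The joint weight of source value \<open>x\<close> and pretty good outcome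
    \<open>x'\<close>; its total can be below one because the remainder of the measurement is left
    out.\<close>
  define J1 where "J1 x x' = pmf X x * pmf X x' * Re (tr (\<rho> x * K1 * (\<rho> x' * K1)))" for x x'
  define J2 where "J2 y y' = pmf Y y * pmf Y y' * Re (tr (\<sigma> y * K2 * (\<sigma> y' * K2)))" for y y'
  \<comment> \<open>The halves in \<open>s a\<close> and \<open>s b\<close> give
    \<open>1 / 4\<close>, and the square of \<open>sign_mat\<close> has trace 2.\<close>
  have tr_pair: "Re (tr (complex_of_real (s a) \<cdot>\<^sub>m V a * K * (complex_of_real (s b) \<cdot>\<^sub>m V b * K)))
      = 1 / 2 * (bit_sign (E (fst b) (snd b)) * (J1 (fst a) (fst b) * J2 (snd a) (snd b) * bit_sign (E (fst a) (snd a))))"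
    if a: "a \<in> ?S" and b: "b \<in> ?S" for a b
  proof -
    have VK: "V a * K = sign_mat \<otimes>\<^sub>k (\<rho> (fst a) * K1) \<otimes>\<^sub>k (\<sigma> (snd a) * K2)" if "a \<in> ?S" for a
      using that \<rho>c \<sigma>c c unfolding V_def K_def
      by (auto simp: kron3_mult[of _ _ _ d1 _ _ d2] right_mult_one_mat[of _ 2 2])
    have ca: "\<rho> (fst a) \<in> carrier_mat d1 d1" "\<sigma> (snd a) \<in> carrier_mat d2 d2"
      "\<rho> (fst b) \<in> carrier_mat d1 d1" "\<sigma> (snd b) \<in> carrier_mat d2 d2"
      using a b \<rho>c \<sigma>c by auto
    have "complex_of_real (s a) \<cdot>\<^sub>m V a * K * (complex_of_real (s b) \<cdot>\<^sub>m V b * K)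
        = complex_of_real (s a * s b) \<cdot>\<^sub>m (V a * K * (V b * K))"
      using Vc[OF a] Vc[OF b] Kc
      by (simp add: mult_smult_assoc_mat[of _ ?N ?N _ ?N] mult_smult_distrib[of _ ?N ?N _ ?N] smult_smult_mat mult.commute)
    also have "V a * K * (V b * K)
        = 1\<^sub>m 2 \<otimes>\<^sub>k (\<rho> (fst a) * K1 * (\<rho> (fst b) * K1)) \<otimes>\<^sub>k (\<sigma> (snd a) * K2 * (\<sigma> (snd b) * K2))"
      unfolding VK[OF a] VK[OF b] using ca c
      by (subst kron3_mult[of _ _ _ d1 _ _ d2]) (auto simp: sign_mat_square)
    finally have "tr (complex_of_real (s a) \<cdot>\<^sub>m V a * K * (complex_of_real (s b) \<cdot>\<^sub>m V b * K))
        = complex_of_real (s a * s b) * (2 * tr (\<rho> (fst a) * K1 * (\<rho> (fst b) * K1)) * tr (\<sigma> (snd a) * K2 * (\<sigma> (snd b) * K2)))"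
      using ca c by (simp add: tr_smult[of _ ?N] tr_kron3[of _ _ d1 _ d2])
    \<comment> \<open>Nonnegativity makes both traces real, so \<open>Re\<close> is multiplicative
      on their product.\<close>
    moreover have "0 \<le> tr (\<rho> (fst a) * K1 * (\<rho> (fst b) * K1))" "0 \<le> tr (\<sigma> (snd a) * K2 * (\<sigma> (snd b) * K2))"
      using a b nonneg1 nonneg2 by auto
    ultimately have "Re (tr (complex_of_real (s a) \<cdot>\<^sub>m V a * K * (complex_of_real (s b) \<cdot>\<^sub>m V b * K)))
        = s a * s b * (2 * Re (tr (\<rho> (fst a) * K1 * (\<rho> (fst b) * K1))) * Re (tr (\<sigma> (snd a) * K2 * (\<sigma> (snd b) * K2))))"
      by (simp add: less_eq_complex_def)
    then show ?thesis by (simp add: s_def J1_def J2_def)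
  qed
  have "Re (tr (D * K * (D * K))) = (\<Sum>a\<in>?S. \<Sum>b\<in>?S. Re (tr (complex_of_real (s a) \<cdot>\<^sub>m V a * K * (complex_of_real (s b) \<cdot>\<^sub>m V b * K))))"
  proof -
    have "D * K = sum_mat ?N (\<lambda>a. complex_of_real (s a) \<cdot>\<^sub>m V a * K) ?S"
      unfolding D_def using Vc Kc by (intro sum_mat_mult) auto
    then show ?thesis using Vc Kc by (simp add: tr_sum_mat_mult_sum_mat Re_sum)
  qed
  \<comment> \<open>The index of the second copy of \<open>D\<close> moves outside: \<open>b\<close>
    now plays the pair of measurement outcomes and \<open>a\<close> the pair of source
    values.\<close>
  also have "\<dots> = (\<Sum>b\<in>?S. \<Sum>a\<in>?S. 1 / 2 * (bit_sign (E (fst b) (snd b)) * (J1 (fst a) (fst b) * J2 (snd a) (snd b) * bit_sign (E (fst a) (snd a)))))"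
    by (subst sum.swap) (intro sum.cong refl tr_pair)
  also have "\<dots> = 1 / 2 * (\<Sum>x'\<in>bits n. \<Sum>y'\<in>bits n. bit_sign (E x' y') *
      (\<Sum>x\<in>bits n. \<Sum>y\<in>bits n. J1 x x' * J2 y y' * bit_sign (E x y)))"
    by (simp add: sum.cartesian_product' sum_distrib_left)
  also have "\<dots> \<le> 1 / 2 * (4 * \<epsilon>)"
  proof (intro mult_left_mono extractor_classical_side_information[OF assms(2)])
    show "0 \<le> J1 x x'" "0 \<le> J2 x x'" if "x \<in> bits n" "x' \<in> bits n" for x x'
      using nonneg1[OF that] nonneg2[OF that] by (auto simp: J1_def J2_def less_eq_complex_def)
    show "(\<Sum>x'\<in>bits n. J1 (g x') x') \<le> \<epsilon> * 2 powr (- k1)" if "g \<in> bits n \<rightarrow> bits n" for g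
      using guess1[OF that] by (simp only: J1_def powr)
    show "(\<Sum>x'\<in>bits n. J2 (g x') x') \<le> \<epsilon> * 2 powr (- k2)" if "g \<in> bits n \<rightarrow> bits n" for g
      using guess2[OF that] by (simp only: J2_def powr)
  qed (use assms(1) total1 total2 in \<open>simp_all add: J1_def J2_def\<close>)
  finally have DKDK: "Re (tr (D * K * (D * K))) \<le> 2 * \<epsilon>" by simp

  have "(tr_norm D)\<^sup>2 \<le> 1 / 4 * (Re (tr (D * K * (D * K))) * Re (tr (G * G)))"
    by (rule tr_norm_weighted[OF Dc Dh G K GK KG])
  also have "\<dots> \<le> 1 / 4 * (2 * \<epsilon> * (72 / 25))"
    unfolding trGG using DKDK by simp
  also have "\<dots> \<le> 3 * \<epsilon> / 2" using assms(1) by simp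
  finally have "tr_norm D \<le> sqrt (3 * \<epsilon> / 2)" by (rule real_le_rsqrt)
  moreover have "sum_mat (2 ^ 1 * (d1 * d2))
        (\<lambda>(x, y). of_real (pmf X x * pmf Y y) \<cdot>\<^sub>m (basis_proj (E x y) \<otimes>\<^sub>k \<rho> x \<otimes>\<^sub>k \<sigma> y)) ?S
      - maximally_mixed (2 ^ 1) \<otimes>\<^sub>k
        sum_mat (d1 * d2) (\<lambda>(x, y). of_real (pmf X x * pmf Y y) \<cdot>\<^sub>m (\<rho> x \<otimes>\<^sub>k \<sigma> y)) ?S = D"
    using EP \<rho>c \<sigma>c
    by (subst extractor_error_eq) (auto simp: D_def s_def V_def case_prod_unfold Pi_iff)
  ultimately show "tr_norm
      (sum_mat (2 ^ 1 * (d1 * d2))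
        (\<lambda>(x, y). of_real (pmf X x * pmf Y y) \<cdot>\<^sub>m (basis_proj (E x y) \<otimes>\<^sub>k \<rho> x \<otimes>\<^sub>k \<sigma> y)) ?S
      - maximally_mixed (2 ^ 1) \<otimes>\<^sub>k
        sum_mat (d1 * d2) (\<lambda>(x, y). of_real (pmf X x * pmf Y y) \<cdot>\<^sub>m (\<rho> x \<otimes>\<^sub>k \<sigma> y)) ?S)
      \<le> sqrt (3 * \<epsilon> / 2)" by simp
qed

end
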